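(* For critical site percolation on the triangular lattice, the cluster graph has a unique infinite component almost surely, denoted by $\mathscr{C}$. Moreover, there exists a constant $C>0$ such that for any $k\geq 1$, $$\mathbf{P}_{1/2}[\operatorname{dist}(0,\mathscr{C})\geq k]\leq \exp(-Ck).$$
   Context: Triangular lattice $\mathbb{T}$: site set $\mathbb{V}=\{x+ye^{\pi i/3}\in\mathbb{C}:x,y\in\mathbb{Z}\}$, bonds connecting adjacent sites (Euclidean distance 1); each site is also viewed as the hexagon centered at it of the dual hexagonal lattice. Under $\mathbf{P}_{1/2}$ each site is independently open or closed with probability $1/2$ each (critical site percolation). Open clusters are the connected components of the set of open sites. Cluster graph: the vertices are the open clusters (each contracted to a single vertex); two distinct open clusters $\mathcal{C},\mathcal{C}'$ are joined by an edge if there exists a closed hexagon touching both of them (i.e. a closed site adjacent to a site of $\mathcal{C}$ and to a site of $\mathcal{C}'$). An infinite component is a connected component of this graph having infinitely many vertices. The cluster graph is embedded in the plane by viewing each open cluster as a vertex; $\operatorname{dist}$ denotes Euclidean distance, so $\operatorname{dist}(0,\mathscr{C})$ is the Euclidean distance from $0$ to the union of the open clusters belonging to $\mathscr{C}$. *)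

theory Defs
  imports "HOL-Probability.Probability"
begin

definition sites :: "complex set" where
  "sites = {of_int x + of_int y * exp (\<i> * of_real pi / 3) | x y :: int. True}"

definition site_adj :: "(complex \<times> complex) set" where
  "site_adj = {(u, v). u \<in> sites \<and> v \<in> sites \<and> dist u v = 1}"

text \<open>A configuration assigns \<^const>\<open>True\<close> to open sites and \<^const>\<open>False\<close> to closed ones.\<close>

definition site_percolation :: "real \<Rightarrow> (complex \<Rightarrow> bool) measure" where
  "site_percolation p = PiM sites (\<lambda>_. measure_pmf (bernoulli_pmf p))"

text \<open>Vertex sets of the connected components of the graph on \<open>V\<close> whose edges are
  given by the restriction to \<open>V\<close> of a symmetric relation \<open>E\<close>.\<close>

definition connected_components :: "'v set \<Rightarrow> ('v \<times> 'v) set \<Rightarrow> 'v set set" where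
  "connected_components V E = V // {(u, v). u \<in> V \<and> v \<in> V \<and> (u, v) \<in> (E \<inter> V \<times> V)\<^sup>*}"

definition open_sites :: "(complex \<Rightarrow> bool) \<Rightarrow> complex set" where
  "open_sites \<omega> = {v \<in> sites. \<omega> v}"

definition closed_sites :: "(complex \<Rightarrow> bool) \<Rightarrow> complex set" where
  "closed_sites \<omega> = {v \<in> sites. \<not> \<omega> v}"

definition open_clusters :: "(complex \<Rightarrow> bool) \<Rightarrow> complex set set" where
  "open_clusters \<omega> = connected_components (open_sites \<omega>) site_adj"

definition cluster_adj :: "(complex \<Rightarrow> bool) \<Rightarrow> (complex set \<times> complex set) set" where
  "cluster_adj \<omega> = {(A, B). A \<in> open_clusters \<omega> \<and> B \<in> open_clusters \<omega> \<and> A \<noteq> B \<and>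
     (\<exists>v \<in> closed_sites \<omega>. (\<exists>a \<in> A. (v, a) \<in> site_adj) \<and> (\<exists>b \<in> B. (v, b) \<in> site_adj))}"

text \<open>Here \<^term>\<open>infinite K\<close> counts the clusters in \<open>K\<close>, not the sites they contain.\<close>

definition infinite_component :: "(complex \<Rightarrow> bool) \<Rightarrow> complex set set \<Rightarrow> bool" where
  "infinite_component \<omega> K \<longleftrightarrow>
     K \<in> connected_components (open_clusters \<omega>) (cluster_adj \<omega>) \<and> infinite K"

text \<open>When there is no unique infinite component the value is set to the empty set; a bare
  \<open>THE\<close> would be unspecified there, possibly in a way that is not measurable in \<open>\<omega>\<close>.\<close>

definition the_infinite_component :: "(complex \<Rightarrow> bool) \<Rightarrow> complex set set" where
  "the_infinite_component \<omega> =
     (if \<exists>!K. infinite_component \<omega> K then THE K. infinite_component \<omega> K else {})"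

definition dist_infinite_component :: "(complex \<Rightarrow> bool) \<Rightarrow> real" where
  "dist_infinite_component \<omega> = infdist 0 (\<Union> (the_infinite_component \<omega>))"

end

theory Submission
  imports Defs
begin

text \<open>
  Two open clusters are adjacent iff they contain sites with a common neighbour, so the components of
  the cluster graph are the components of the open sites for the relation ``in a common closed
  neighbourhood'' (\<open>link\<close>). Let \<open>A\<close> be such a component and \<open>U = nbh A\<close>. Along every boundary
  contour of \<open>U\<close> the sites on both sides are closed, and each inner one has an open neighbour in \<open>A\<close>.

  Peierls argument: given the starting edge, a contour is traced deterministically from the knowledge
  of which visited sites lie in \<open>U\<close>. Hence for distinct contours, visiting \<open>D\<close> sites each, the events
  that an auxiliary fair colouring agrees with \<open>U\<close> on the visited sites are disjoint, and the sum of
  \<open>(1/2)^D\<close> is at most 1, which exactly balances the cost of having all visited sites closed. The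
  additional open neighbours gain a factor that is exponentially small in the number of inner sites.

  Since a finite \<open>A\<close> containing a segment of length \<open>n\<close> has a contour with more than \<open>n\<close> inner sites, a
  segment of length \<open>n\<close> is near an infinite component up to probability \<open>O(rho^n)\<close>. Two infinite
  components would be separated by an infinite contour. Finally, along a line there are infinitely
  many isolated open sites in the infinite component, so that it consists of infinitely many clusters
  (no use is made of the absence of infinite open clusters at criticality).
\<close>

subsection \<open>Boundary contours\<close>

text \<open>The balance at 1/2 leaves no room for counting contours: they are only compared with the
  fair colouring, and all decay comes from the extra open neighbours. The comparison needs disjoint
  colouring events, so a contour is cut at the first time when it has met \<open>d\<close> inner
  sites, a time that the colouring itself reveals. The neighbour conditions become independent after
  thinning to one of nine residue classes modulo 3, whence the ninth root in \<open>rho\<close>.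

  The bound for one starting edge carries a finite set \<open>B\<close> with a prescribed pattern
  and keeps the factor \<open>(1/2) ^ card B\<close>. Summed over all patterns this factor
  disappears, which allows a segment to be treated as if it were open; for one fixed pattern it
  bounds a conditional probability, which allows a local configuration to be planted. Planarity
  enters through the parity of the crossings of a ray. The prefactor of the exponential tail is
  absorbed at the end by the positive probability that the origin lies in the infinite
  component.\<close>

definition adj :: "int \<times> int \<Rightarrow> int \<times> int \<Rightarrow> bool" where
  "adj u v \<longleftrightarrow> v - u \<in> {(1,0), (0,1), (-1,1), (-1,0), (0,-1), (1,-1)}"

definition nbh :: "(int \<times> int) set \<Rightarrow> (int \<times> int) set" where
  "nbh A = {v. \<exists>u\<in>A. v = u \<or> adj u v}"

text \<open>If \<open>(p, q)\<close> stands for p + q zeta with zeta = exp(pi i/3), multiplication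
  by zeta sends \<open>(p, q)\<close> to \<open>(-q, p + q)\<close>. So this is \<open>w\<close>
  turned by 60 degrees counterclockwise about \<open>b\<close>, the third corner of a lattice
  triangle.\<close>

definition front :: "int \<times> int \<Rightarrow> int \<times> int \<Rightarrow> int \<times> int" where
  "front b w = (fst b - snd w + snd b, snd b + (fst w - fst b) + (snd w - snd b))"

text \<open>A pair \<open>(b, w)\<close> with \<open>b \<in> U\<close> and \<open>w \<notin> U\<close> stands for the hexagon side between \<open>b\<close> and \<open>w\<close>; \<open>front\<close>
  is the next hexagon met when walking along that side with \<open>b\<close> to one fixed hand.\<close>

definition step :: "(int \<times> int) set \<Rightarrow> (int \<times> int) \<times> (int \<times> int) \<Rightarrow> (int \<times> int) \<times> (int \<times> int)" where
  "step U e = (if front (fst e) (snd e) \<in> U then (front (fst e) (snd e), snd e) else (fst e, front (fst e) (snd e)))"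

definition bdry :: "(int \<times> int) set \<Rightarrow> ((int \<times> int) \<times> (int \<times> int)) set" where
  "bdry U = {(b, w). adj b w \<and> b \<in> U \<and> w \<notin> U}"

definition contour :: "(int \<times> int) set \<Rightarrow> (int \<times> int) \<times> (int \<times> int) \<Rightarrow> nat \<Rightarrow> (int \<times> int) \<times> (int \<times> int)" where
  "contour U e i = (step U ^^ i) e"

definition inner_sites :: "(int \<times> int) set \<Rightarrow> (int \<times> int) \<times> (int \<times> int) \<Rightarrow> nat \<Rightarrow> (int \<times> int) set" where
  "inner_sites U e m = (\<lambda>i. fst (contour U e i)) ` {..m}"

definition outer_sites :: "(int \<times> int) set \<Rightarrow> (int \<times> int) \<times> (int \<times> int) \<Rightarrow> nat \<Rightarrow> (int \<times> int) set" where
  "outer_sites U e m = (\<lambda>i. snd (contour U e i)) ` {..m}"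

lemma adj_pair: "adj (a,b) (c,d) \<longleftrightarrow>
    c = a + 1 \<and> d = b \<or> c = a \<and> d = b + 1 \<or> c = a - 1 \<and> d = b + 1 \<or>
    c = a - 1 \<and> d = b \<or> c = a \<and> d = b - 1 \<or> c = a + 1 \<and> d = b - 1"
  unfolding adj_def by (simp add: diff_eq_eq) (metis add.commute uminus_add_conv_diff)

lemma adj_sym_imp: "adj u v \<Longrightarrow> adj v u"
  by (cases u; cases v) (simp only: adj_pair, elim disjE conjE, simp_all)

lemma adj_sym: "adj u v \<longleftrightarrow> adj v u"
  using adj_sym_imp by blast

lemma adj_irrefl [simp]: "\<not> adj u u"
  by (cases u) (simp add: adj_pair)

lemma finite_adj: "finite {v. adj u v}"
proof -
  have "{v. adj u v} = (\<lambda>d. u + d) ` {(1,0), (0,1), (-1,1), (-1,0), (0,-1), (1,-1)}"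
    by (auto simp: adj_def image_iff algebra_simps)
  then show ?thesis by simp
qed

lemma card_adj: "card {v. adj u v} \<le> 6"
proof -
  have "{v. adj u v} = (\<lambda>d. u + d) ` {(1,0), (0,1), (-1,1), (-1,0), (0,-1), (1,-1)}"
    by (auto simp: adj_def image_iff algebra_simps)
  also have "card \<dots> \<le> card {(1::int,0::int), (0,1), (-1,1), (-1,0), (0,-1), (1,-1)}"
    by (rule card_image_le) simp
  finally show ?thesis by simp
qed

lemma nbh_mono: "A \<subseteq> B \<Longrightarrow> nbh A \<subseteq> nbh B"
  by (auto simp: nbh_def)

lemma subset_nbh: "A \<subseteq> nbh A"
  by (auto simp: nbh_def)

lemma finite_nbh: "finite A \<Longrightarrow> finite (nbh A)"
proof -
  assume "finite A"
  moreover have "nbh A = A \<union> (\<Union>u\<in>A. {v. adj u v})" by (auto simp: nbh_def)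
  ultimately show ?thesis using finite_adj by auto
qed

lemma adj_front: "adj b w \<Longrightarrow> adj b (front b w)" "adj b w \<Longrightarrow> adj (front b w) w"
  by (cases b; cases w; simp only: adj_pair front_def fst_conv snd_conv; elim disjE conjE; simp)+

lemma bdry_iff: "e \<in> bdry U \<longleftrightarrow> adj (fst e) (snd e) \<and> fst e \<in> U \<and> snd e \<notin> U"
  by (cases e) (simp add: bdry_def)

lemma step_bdry: "e \<in> bdry U \<Longrightarrow> step U e \<in> bdry U"
  using adj_front by (auto simp: bdry_def step_def)

lemma contour_0 [simp]: "contour U e 0 = e"
  by (simp add: contour_def)

lemma contour_Suc: "contour U e (Suc i) = step U (contour U e i)"
  by (simp add: contour_def)

lemma contour_bdry: "e \<in> bdry U \<Longrightarrow> contour U e i \<in> bdry U"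
  by (induction i) (auto simp: contour_Suc step_bdry)

text \<open>The predecessor of an edge is found by turning at the other common neighbour of its ends.\<close>

lemma inj_on_step: "inj_on (step U) (bdry U)"
proof (rule inj_onI)
  fix e e' assume e: "e \<in> bdry U" "e' \<in> bdry U" "step U e = step U e'"
  obtain a b c d where [simp]: "e = ((a,b),(c,d))" by (metis prod.exhaust)
  obtain a' b' c' d' where [simp]: "e' = ((a',b'),(c',d'))" by (metis prod.exhaust)
  have 1: "(a,b) \<in> U" "(a',b') \<in> U" "(c,d) \<notin> U" "(c',d') \<notin> U" using e by (auto simp: bdry_def)
  have eq: "step U ((a,b),(c,d)) = step U ((a',b'),(c',d'))" using e by simp
  let ?f = "(a - d + b, b + (c - a) + (d - b))"
  let ?f' = "(a' - d' + b', b' + (c' - a') + (d' - b'))"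
  have s: "step U ((a,b),(c,d)) = (if ?f \<in> U then (?f,(c,d)) else ((a,b),?f))"
    "step U ((a',b'),(c',d')) = (if ?f' \<in> U then (?f',(c',d')) else ((a',b'),?f'))"
    by (auto simp: step_def front_def)
  consider "?f \<in> U" "?f' \<in> U" | "?f \<in> U" "?f' \<notin> U" | "?f \<notin> U" "?f' \<in> U" | "?f \<notin> U" "?f' \<notin> U" by blast
  then show "e = e'"
  proof cases
    case 1 then show ?thesis using eq s by auto
  next
    \<comment> \<open>In the mixed cases both edges lie on one triangle, and the inner site of one
      edge would be the outer site of the other.\<close>
    case 2
    then have "?f = (a',b')" "(c,d) = ?f'" using eq s by auto
    then have "a = c'" "b = d'" by auto
    then show ?thesis using 1 \<open>(a,b) \<in> U\<close> \<open>(c',d') \<notin> U\<close> by auto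
  next
    case 3
    then have "?f' = (a,b)" "(c',d') = ?f" using eq s by auto
    then have "a' = c" "b' = d" by auto
    then show ?thesis using 1 \<open>(a',b') \<in> U\<close> \<open>(c,d) \<notin> U\<close> by auto
  next
    case 4 then show ?thesis using eq s by auto
  qed
qed

lemma inner_mono: "m \<le> m' \<Longrightarrow> inner_sites U e m \<subseteq> inner_sites U e m'"
  by (auto simp: inner_sites_def)

lemma finite_inner [simp]: "finite (inner_sites U e m)" and finite_outer [simp]: "finite (outer_sites U e m)"
  by (auto simp: inner_sites_def outer_sites_def)

lemma inner_subset: "e \<in> bdry U \<Longrightarrow> inner_sites U e m \<subseteq> U"
  using contour_bdry[of e U] by (auto simp: inner_sites_def bdry_iff)

lemma outer_subset: "e \<in> bdry U \<Longrightarrow> outer_sites U e m \<inter> U = {}"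
  using contour_bdry[of e U] by (auto simp: outer_sites_def bdry_iff)

text \<open>Each step consults \<open>U\<close> only at the \<open>front\<close> site, and this site
  becomes an end of the next edge. So the visited sites contain all the information that was
  used.\<close>

lemma contour_cong:
  assumes "\<And>x. x \<in> inner_sites U e m \<union> outer_sites U e m \<Longrightarrow> x \<in> V \<longleftrightarrow> x \<in> U" "i \<le> m"
  shows "contour V e i = contour U e i"
  using assms(2)
proof (induction i)
  case (Suc i)
  let ?e = "contour U e i" and ?f = "front (fst (contour U e i)) (snd (contour U e i))"
  have eq: "contour V e i = ?e" using Suc by simp
  have "fst (contour U e (Suc i)) = ?f \<or> snd (contour U e (Suc i)) = ?f"
    by (auto simp: contour_Suc step_def)
  then have "?f \<in> inner_sites U e m \<union> outer_sites U e m"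
    using Suc.prems by (auto simp: inner_sites_def outer_sites_def image_iff) (metis atMost_iff)+
  then have "?f \<in> V \<longleftrightarrow> ?f \<in> U" using assms(1) by blast
  then show ?case by (simp add: contour_Suc eq step_def)
qed simp

lemma inner_outer_cong:
  assumes "\<And>i. i \<le> m \<Longrightarrow> contour V e i = contour U e i"
  shows "inner_sites V e m = inner_sites U e m" "outer_sites V e m = outer_sites U e m"
  using assms by (auto simp: inner_sites_def outer_sites_def)

text \<open>The outer end of an edge is next to its inner end, so infinitely many edges need
  infinitely many inner sites.\<close>

lemma finite_orbit:
  assumes "e \<in> bdry U" "\<And>m. card (inner_sites U e m) < d"
  shows "finite (range (contour U e))"
proof -
  let ?I = "\<Union>m. inner_sites U e m"
  have "finite ?I"
  proof (rule ccontr)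
    assume "infinite ?I"
    then obtain F where F: "finite F" "card F = d" "F \<subseteq> ?I" using infinite_arbitrarily_large by blast
    then have "\<forall>x\<in>F. \<exists>m. x \<in> inner_sites U e m" by auto
    then obtain h where h: "\<And>x. x \<in> F \<Longrightarrow> x \<in> inner_sites U e (h x)" by metis
    have "F \<subseteq> inner_sites U e (Max (insert 0 (h ` F)))"
    proof
      fix x assume "x \<in> F"
      then have "h x \<le> Max (insert 0 (h ` F))" using F by (intro Max_ge) auto
      then show "x \<in> inner_sites U e (Max (insert 0 (h ` F)))" using h[OF \<open>x \<in> F\<close>] inner_mono by blast
    qed
    then have "d \<le> card (inner_sites U e (Max (insert 0 (h ` F))))" using F card_mono finite_inner by metis
    then show False using assms(2) by (meson not_less)
  qed
  moreover have "range (contour U e) \<subseteq> ?I \<times> nbh ?I"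
  proof
    fix x assume "x \<in> range (contour U e)"
    then obtain i where i: "x = contour U e i" by auto
    then have "fst x \<in> inner_sites U e i" by (auto simp: inner_sites_def)
    moreover have "adj (fst x) (snd x)" using contour_bdry[OF assms(1), of i] i by (simp add: bdry_iff)
    ultimately show "x \<in> ?I \<times> nbh ?I" by (cases x) (auto simp: nbh_def)
  qed
  ultimately show ?thesis using finite_nbh finite_subset by blast
qed

text \<open>An injective map of a finite set into itself is onto, so a finite contour closes up.
  Closedness is used below in this form, which passes to unions of cycles.\<close>

lemma step_orbit:
  assumes "e \<in> bdry U" "finite (range (contour U e))"
  shows "step U ` range (contour U e) = range (contour U e)"
proof (rule card_subset_eq[OF assms(2)])
  show "step U ` range (contour U e) \<subseteq> range (contour U e)"
    by (auto simp: contour_Suc[symmetric])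
  have "range (contour U e) \<subseteq> bdry U" using contour_bdry[OF assms(1)] by auto
  then show "card (step U ` range (contour U e)) = card (range (contour U e))"
    using inj_on_step inj_on_subset card_image by metis
qed

subsection \<open>The two sides of a finite contour\<close>

definition crosses :: "((int \<times> int) \<times> (int \<times> int)) set \<Rightarrow> int \<times> int \<Rightarrow> int \<times> int \<Rightarrow> bool" where
  "crosses \<Gamma> u v \<longleftrightarrow> (u, v) \<in> \<Gamma> \<or> (v, u) \<in> \<Gamma>"

lemma crosses_sym: "crosses \<Gamma> u v = crosses \<Gamma> v u"
  by (auto simp: crosses_def)

lemma front_cases:
  assumes "adj u v" "adj v w" "adj u w"
  shows "w = front u v \<or> w = front v u"
  using assms
  by (cases u; cases v; cases w) (simp only: adj_pair front_def fst_conv snd_conv, elim disjE conjE, simp_all)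

lemma front_rotate:
  assumes "adj b w" shows "front w (front b w) = b" "front (front b w) b = w"
  using assms by (cases b; cases w; simp add: front_def)+

text \<open>Going around a triangle, a closed contour enters and leaves it equally often.\<close>

lemma crosses_triangle_aux:
  assumes G: "\<Gamma> \<subseteq> bdry U" "step U ` \<Gamma> = \<Gamma>" and uv: "adj u v" "(u, v) \<in> bdry U"
  shows "(u, v) \<in> \<Gamma> \<longleftrightarrow> (if front u v \<in> U then (front u v, v) \<in> \<Gamma> else (u, front u v) \<in> \<Gamma>)"
proof -
  have "(u, v) \<in> \<Gamma> \<longleftrightarrow> step U (u, v) \<in> \<Gamma>"
  proof
    assume "step U (u, v) \<in> \<Gamma>"
    then have "step U (u, v) \<in> step U ` \<Gamma>" using G by simp
    then obtain e where "e \<in> \<Gamma>" "step U (u,v) = step U e" by auto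
    then show "(u, v) \<in> \<Gamma>" using inj_on_step[of U] uv G by (metis inj_onD subsetD)
  qed (use G in auto)
  then show ?thesis by (simp add: step_def)
qed

text \<open>Up to orientation a triangle has no side or two sides in \<open>bdry U\<close>, and
  \<open>step\<close> leads from one of the two to the other; so \<open>\<Gamma>\<close> contains
  both or neither.\<close>

lemma crosses_triangle_front:
  assumes G: "\<Gamma> \<subseteq> bdry U" "step U ` \<Gamma> = \<Gamma>" and "adj u v" "w = front u v"
  shows "crosses \<Gamma> u w \<longleftrightarrow> (crosses \<Gamma> u v \<noteq> crosses \<Gamma> v w)"
proof -
  have adj: "adj u v" "adj v w" "adj w u" "adj v u" "adj w v" "adj u w"
    using assms adj_front adj_sym by blast+
  have fr: "front u v = w" "front v w = u" "front w u = v" using assms front_rotate by auto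
  note aux = crosses_triangle_aux[OF G]
  have mem: "\<And>x y. (x, y) \<in> \<Gamma> \<Longrightarrow> x \<in> U \<and> y \<notin> U" using G by (auto simp: bdry_def)
  show ?thesis
    using aux[of u v] aux[of v w] aux[of w u] adj fr mem
    unfolding crosses_def bdry_def mem_Collect_eq case_prod_conv
    by (smt (verit, best))
qed

lemma crosses_triangle:
  assumes "\<Gamma> \<subseteq> bdry U" "step U ` \<Gamma> = \<Gamma>" and "adj u v" "adj v w" "adj u w"
  shows "crosses \<Gamma> u w \<longleftrightarrow> (crosses \<Gamma> u v \<noteq> crosses \<Gamma> v w)"
proof -
  consider "w = front u v" | "w = front v u" using front_cases assms by blast
  then show ?thesis
  proof cases
    case 1 then show ?thesis using crosses_triangle_front assms by blast
  next
    case 2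
    then have "crosses \<Gamma> v w \<longleftrightarrow> (crosses \<Gamma> v u \<noteq> crosses \<Gamma> u w)"
      using crosses_triangle_front[of \<Gamma> U v u w] assms adj_sym by blast
    then show ?thesis using crosses_sym by blast
  qed
qed

text \<open>The side of a closed contour on which a site lies is the parity of the number of crossings of a
  horizontal ray.\<close>

definition hray :: "((int \<times> int) \<times> (int \<times> int)) set \<Rightarrow> int \<times> int \<Rightarrow> int set" where
  "hray \<Gamma> u = {i. fst u \<le> i \<and> crosses \<Gamma> (i, snd u) (i + 1, snd u)}"

definition side :: "((int \<times> int) \<times> (int \<times> int)) set \<Rightarrow> int \<times> int \<Rightarrow> bool" where
  "side \<Gamma> u \<longleftrightarrow> odd (card (hray \<Gamma> u))"

lemma finite_bound:
  assumes "finite (\<Gamma> :: ((int \<times> int) \<times> (int \<times> int)) set)"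
  obtains N :: int where "\<And>u v. crosses \<Gamma> u v \<Longrightarrow> \<bar>fst u\<bar> < N \<and> \<bar>snd u\<bar> < N \<and> \<bar>fst v\<bar> < N \<and> \<bar>snd v\<bar> < N"
proof -
  let ?S = "(\<lambda>e. \<bar>fst (fst e)\<bar>) ` \<Gamma> \<union> (\<lambda>e. \<bar>snd (fst e)\<bar>) ` \<Gamma> \<union> (\<lambda>e. \<bar>fst (snd e)\<bar>) ` \<Gamma> \<union> (\<lambda>e. \<bar>snd (snd e)\<bar>) ` \<Gamma>"
  have "finite ?S" using assms by auto
  then have "\<exists>N. \<forall>x\<in>?S. x < N"
    by (intro exI[of _ "Max ?S + 1"]) (simp add: Max_ge zle_add1_eq_le)
  then obtain N where N: "\<forall>x\<in>?S. x < N" by blast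
  then have "\<bar>fst (fst e)\<bar> < N \<and> \<bar>snd (fst e)\<bar> < N \<and> \<bar>fst (snd e)\<bar> < N \<and> \<bar>snd (snd e)\<bar> < N"
    if "e \<in> \<Gamma>" for e using that by (simp add: ball_Un)
  then show ?thesis using that[of N] unfolding crosses_def by (metis fst_conv snd_conv)
qed

lemma side_horizontal:
  assumes "finite \<Gamma>"
  shows "side \<Gamma> (x, y) \<longleftrightarrow> (side \<Gamma> (x + 1, y) \<noteq> crosses \<Gamma> (x, y) (x + 1, y))"
proof -
  obtain N where N: "\<And>u v. crosses \<Gamma> u v \<Longrightarrow> \<bar>fst u\<bar> < N \<and> \<bar>snd u\<bar> < N \<and> \<bar>fst v\<bar> < N \<and> \<bar>snd v\<bar> < N"
    using finite_bound[OF assms] by blast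
  have "hray \<Gamma> (x + 1, y) \<subseteq> {x + 1..N}" using N by (force simp: hray_def)
  then have fin: "finite (hray \<Gamma> (x + 1, y))" using finite_subset by blast
  have "hray \<Gamma> (x, y) = (if crosses \<Gamma> (x, y) (x + 1, y) then insert x (hray \<Gamma> (x + 1, y)) else hray \<Gamma> (x + 1, y))"
    by (auto simp: hray_def) (metis order_le_less zless_imp_add1_zle)+
  moreover have "x \<notin> hray \<Gamma> (x + 1, y)" by (auto simp: hray_def)
  ultimately show ?thesis using fin by (simp add: side_def)
qed

lemma side_eventually_right:
  assumes "\<And>u v. crosses \<Gamma> u v \<Longrightarrow> \<bar>fst u\<bar> < N" "N \<le> x"
  shows "\<not> side \<Gamma> (x, y)"
proof -
  have "hray \<Gamma> (x, y) = {}" using assms by (force simp: hray_def)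
  then show ?thesis by (simp add: side_def)
qed

text \<open>This is clear far to the right, where no edge of \<open>\<Gamma>\<close> is left, and is
  carried to the left one column at a time: the strip between the two rays is cut into triangles,
  and each of them has an even number of crossed sides.\<close>

lemma side_vertical:
  assumes G: "finite \<Gamma>" "\<Gamma> \<subseteq> bdry U" "step U ` \<Gamma> = \<Gamma>"
  shows "side \<Gamma> (x, y + 1) \<longleftrightarrow> (side \<Gamma> (x, y) \<noteq> crosses \<Gamma> (x, y) (x, y + 1))"
proof -
  obtain N where N: "\<And>u v. crosses \<Gamma> u v \<Longrightarrow> \<bar>fst u\<bar> < N \<and> \<bar>snd u\<bar> < N \<and> \<bar>fst v\<bar> < N \<and> \<bar>snd v\<bar> < N"
    using finite_bound[OF G(1)] by blast
  have far: "side \<Gamma> (x, y + 1) \<longleftrightarrow> (side \<Gamma> (x, y) \<noteq> crosses \<Gamma> (x, y) (x, y + 1))" if "N \<le> x" for x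
  proof -
    have "\<not> crosses \<Gamma> (x, y) (x, y + 1)" using N[of "(x,y)" "(x,y+1)"] that by auto
    then show ?thesis using side_eventually_right[of \<Gamma> N x] N that by blast
  qed
  have "side \<Gamma> (N - int k, y + 1) \<longleftrightarrow> (side \<Gamma> (N - int k, y) \<noteq> crosses \<Gamma> (N - int k, y) (N - int k, y + 1))" for k
  proof (induction k)
    case 0 then show ?case using far by simp
  next
    case (Suc k)
    define z where "z = N - int (Suc k)"
    have z: "N - int k = z + 1" by (simp add: z_def)
    have a: "adj (z, y) (z + 1, y)" "adj (z + 1, y) (z, y + 1)" "adj (z, y) (z, y + 1)"
      "adj (z, y + 1) (z + 1, y + 1)" "adj (z + 1, y) (z + 1, y + 1)"
      by (simp_all add: adj_pair)
    have t1: "crosses \<Gamma> (z, y) (z, y + 1) \<longleftrightarrow> (crosses \<Gamma> (z, y) (z + 1, y) \<noteq> crosses \<Gamma> (z + 1, y) (z, y + 1))"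
      using crosses_triangle[OF G(2,3) a(1,2,3)] .
    have t2: "crosses \<Gamma> (z + 1, y) (z + 1, y + 1) \<longleftrightarrow> (crosses \<Gamma> (z + 1, y) (z, y + 1) \<noteq> crosses \<Gamma> (z, y + 1) (z + 1, y + 1))"
      using crosses_triangle[OF G(2,3) a(2,4,5)] .
    show ?case using Suc.IH t1 t2 side_horizontal[OF G(1), of z y] side_horizontal[OF G(1), of z "y + 1"]
      unfolding z_def[symmetric] z by blast
  qed
  from this[of "nat (N - x)"] show ?thesis using far[of x] by (cases "N \<le> x") simp_all
qed

lemma side_adj:
  assumes G: "finite \<Gamma>" "\<Gamma> \<subseteq> bdry U" "step U ` \<Gamma> = \<Gamma>" and "adj u v"
  shows "side \<Gamma> v \<longleftrightarrow> (side \<Gamma> u \<noteq> crosses \<Gamma> u v)"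
proof -
  note h = side_horizontal[OF G(1)] and v = side_vertical[OF G]
  have d: "side \<Gamma> (x, y + 1) \<longleftrightarrow> (side \<Gamma> (x + 1, y) \<noteq> crosses \<Gamma> (x + 1, y) (x, y + 1))" for x y
  proof -
    have a: "adj (x, y) (x + 1, y)" "adj (x + 1, y) (x, y + 1)" "adj (x, y) (x, y + 1)"
      by (simp_all add: adj_pair)
    show ?thesis using crosses_triangle[OF G(2,3) a(1,2,3)] h[of x y] v[of x y] by blast
  qed
  obtain a b where u: "u = (a, b)" by fastforce
  obtain c e where w: "v = (c, e)" by fastforce
  consider "c = a + 1" "e = b" | "c = a" "e = b + 1" | "c = a - 1" "e = b + 1"
    | "c = a - 1" "e = b" | "c = a" "e = b - 1" | "c = a + 1" "e = b - 1"
    using assms(4) unfolding u w adj_pair by blast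
  then show ?thesis
    unfolding u w
    by cases (use h[of a b] v[of a b] d[of "a - 1" b] h[of "a - 1" b] v[of a "b - 1"] d[of a "b - 1"]
        crosses_sym[of \<Gamma> "(a,b)"] in auto)
qed

text \<open>To the right, above and below, the ray is eventually empty. To the left it may meet
  edges, but a column far to the left has no crossings and can be followed down from the
  top.\<close>

lemma side_far:
  assumes G: "finite \<Gamma>" "\<Gamma> \<subseteq> bdry U" "step U ` \<Gamma> = \<Gamma>"
  shows "finite {u. side \<Gamma> u}"
proof -
  obtain N where N: "\<And>u v. crosses \<Gamma> u v \<Longrightarrow> \<bar>fst u\<bar> < N \<and> \<bar>snd u\<bar> < N \<and> \<bar>fst v\<bar> < N \<and> \<bar>snd v\<bar> < N"
    using finite_bound[OF G(1)] by blast
  have top: "\<not> side \<Gamma> (x, y)" if "N \<le> \<bar>y\<bar>" for x y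
  proof -
    have "hray \<Gamma> (x, y) = {}" using N that by (force simp: hray_def)
    then show ?thesis by (simp add: side_def)
  qed
  have left: "\<not> side \<Gamma> (x, N - int k)" if "x \<le> -N" for x k
  proof (induction k)
    case 0 then show ?case using top by simp
  next
    case (Suc k)
    have "adj (x, N - int k) (x, N - int (Suc k))" by (simp add: adj_pair)
    moreover have "\<not> crosses \<Gamma> (x, N - int k) (x, N - int (Suc k))"
      using N[of "(x, N - int k)" "(x, N - int (Suc k))"] that by auto
    ultimately show ?case using side_adj[OF G] Suc by blast
  qed
  have "{u. side \<Gamma> u} \<subseteq> {-N..N} \<times> {-N..N}"
  proof (clarsimp)
    fix x y assume s: "side \<Gamma> (x, y)"
    then have "\<bar>y\<bar> < N" using top[of y x] by force
    moreover have "x < N" using side_eventually_right[of \<Gamma> N x y] N s by force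
    moreover have "-N < x"
    proof (rule ccontr)
      assume "\<not> -N < x"
      then have "x \<le> - N" by simp
      then have "\<not> side \<Gamma> (x, N - int (nat (N - y)))" by (rule left)
      moreover have "N - int (nat (N - y)) = y" using \<open>\<bar>y\<bar> < N\<close> by simp
      ultimately show False using s by simp
    qed
    ultimately show "- N \<le> x \<and> x \<le> N \<and> - N \<le> y \<and> y \<le> N" by auto
  qed
  then show ?thesis using finite_subset by blast
qed

section \<open>Linked components and the contours around them\<close>

definition link :: "int \<times> int \<Rightarrow> int \<times> int \<Rightarrow> bool" where
  "link u v \<longleftrightarrow> (\<exists>z. u \<in> nbh {z} \<and> v \<in> nbh {z})"

definition links :: "(int \<times> int) set \<Rightarrow> ((int \<times> int) \<times> (int \<times> int)) set" where
  "links S = {(u, v). u \<in> S \<and> v \<in> S \<and> link u v}"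

definition linked :: "(int \<times> int) set \<Rightarrow> int \<times> int \<Rightarrow> (int \<times> int) set" where
  "linked S u = {v. (u, v) \<in> (links S)\<^sup>*}"

lemma nbh_single: "u \<in> nbh {v} \<longleftrightarrow> u = v \<or> adj v u"
  by (auto simp: nbh_def)

lemma nbh_single_sym: "u \<in> nbh {v} \<longleftrightarrow> v \<in> nbh {u}"
  using adj_sym by (auto simp: nbh_def)

lemma link_sym: "link u v \<longleftrightarrow> link v u"
  by (auto simp: link_def)

lemma adj_link: "adj u v \<Longrightarrow> link u v"
  unfolding link_def by (intro exI[of _ u]) (simp add: nbh_def)

lemma nbh_nbh: "x \<in> nbh (nbh A) \<longleftrightarrow> (\<exists>a\<in>A. link a x)"
  unfolding link_def nbh_def using adj_sym by blast

lemma sym_links: "sym (links S)"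
  by (auto simp: sym_def links_def link_sym)

lemma self_linked: "u \<in> linked S u"
  by (simp add: linked_def)

lemma linked_subset: "u \<in> S \<Longrightarrow> linked S u \<subseteq> S"
  unfolding linked_def by (auto elim: rtranclE simp: links_def)

lemma linked_link: "\<lbrakk>a \<in> linked S u; u \<in> S; x \<in> S; link a x\<rbrakk> \<Longrightarrow> x \<in> linked S u"
  using linked_subset[of u S] unfolding linked_def by (auto simp: links_def intro: rtrancl_into_rtrancl)

lemma linked_sym: "v \<in> linked S u \<longleftrightarrow> u \<in> linked S v"
  unfolding linked_def using sym_rtrancl[OF sym_links] by (auto dest: symD)

lemma linked_trans: "v \<in> linked S u \<Longrightarrow> w \<in> linked S v \<Longrightarrow> w \<in> linked S u"
  unfolding linked_def by auto

lemma linked_eq: "v \<in> linked S u \<Longrightarrow> linked S v = linked S u"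
  using linked_sym linked_trans by blast

lemma linked_connected: "a \<in> linked S u \<Longrightarrow> (u, a) \<in> (links (linked S u))\<^sup>*"
proof -
  assume "a \<in> linked S u"
  then have "(u, a) \<in> (links S)\<^sup>*" by (simp add: linked_def)
  then show ?thesis
  proof (induction rule: rtrancl_induct)
    case (step y z)
    then have "y \<in> linked S u" "z \<in> linked S u" by (auto simp: linked_def)
    then have "(y, z) \<in> links (linked S u)" using step(2) by (auto simp: links_def)
    then show ?case using step by auto
  qed simp
qed

lemma crosses_bdry: "\<Gamma> \<subseteq> bdry U \<Longrightarrow> crosses \<Gamma> u v \<Longrightarrow> (u \<in> U) \<noteq> (v \<in> U)"
  by (auto simp: crosses_def bdry_def)

text \<open>Linked sites are joined through a common neighbour by a path inside
  \<open>nbh A\<close>, along which membership in \<open>U\<close> does not change.\<close>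

lemma side_const:
  assumes G: "finite \<Gamma>" "\<Gamma> \<subseteq> bdry U" "step U ` \<Gamma> = \<Gamma>"
    and A: "nbh A \<subseteq> U \<or> nbh A \<inter> U = {}" and "(v, a) \<in> (links A)\<^sup>*"
  shows "side \<Gamma> a = side \<Gamma> v"
  using assms(5)
proof (induction rule: rtrancl_induct)
  case (step y z)
  have *: "side \<Gamma> x = side \<Gamma> x'" if "x \<in> A" "x' \<in> nbh {x}" for x x'
  proof (cases "x' = x")
    case False
    then have "adj x x'" using that by (simp add: nbh_single)
    moreover have "x \<in> nbh A" "x' \<in> nbh A" using that by (auto simp: nbh_def)
    then have "\<not> crosses \<Gamma> x x'" using crosses_bdry[OF G(2)] A by blast
    ultimately show ?thesis using side_adj[OF G] by blast
  qed simp
  obtain w where "y \<in> nbh {w}" "z \<in> nbh {w}" "y \<in> A" "z \<in> A"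
    using step(2) by (auto simp: links_def link_def)
  then have "side \<Gamma> y = side \<Gamma> w" "side \<Gamma> z = side \<Gamma> w" using * nbh_single_sym by blast+
  then show ?case using step by simp
qed simp

lemma finite_bdry: "finite U \<Longrightarrow> finite (bdry U)"
proof (rule finite_subset)
  show "bdry U \<subseteq> U \<times> nbh U" by (auto simp: bdry_def nbh_def)
qed (simp add: finite_nbh)

lemma contour_range_subset: "e \<in> bdry U \<Longrightarrow> range (contour U e) \<subseteq> bdry U"
  using contour_bdry by blast

lemma step_fst_close: "e \<in> bdry U \<Longrightarrow> \<bar>fst (fst (step U e)) - fst (fst e)\<bar> \<le> 1"
proof -
  assume e: "e \<in> bdry U"
  obtain a b c d where [simp]: "e = ((a,b),(c,d))" by (metis prod.exhaust)
  have "adj (a,b) (front (a,b) (c,d))" using e adj_front by (auto simp: bdry_iff)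
  then have "\<bar>fst (front (a,b) (c,d)) - a\<bar> \<le> 1" by (auto simp: adj_pair front_def)
  then show ?thesis by (simp add: step_def)
qed

text \<open>The edge is taken where the row leaves \<open>nbh A\<close> for the last time,
  \<open>j\<close> columns to the right of \<open>x\<close>. Its contour encloses \<open>A\<close>,
  so it must also reach a column at or left of \<open>x\<close>, and its inner sites occupy every
  column on the way. The same \<open>j\<close> locates the starting edge and bounds the length from
  below, so that a union bound over \<open>j\<close> converges.\<close>

lemma enclosing_contour:
  assumes "finite A" "(x, y) \<in> A" "\<And>a. a \<in> A \<Longrightarrow> ((x, y), a) \<in> (links A)\<^sup>*" "(x + int n, y) \<in> A"
  obtains j m where "n < j" "((x + int j, y), (x + int j + 1, y)) \<in> bdry (nbh A)"
    "j \<le> card (inner_sites (nbh A) ((x + int j, y), (x + int j + 1, y)) m)"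
proof -
  let ?U = "nbh A"
  have finU: "finite ?U" using finite_nbh assms by blast
  define J where "J = {j::nat. (x + int j, y) \<in> ?U}"
  have "(\<lambda>j. (x + int j, y)) ` J \<subseteq> ?U" by (auto simp: J_def)
  moreover have "inj_on (\<lambda>j::nat. (x + int j, y)) J" by (auto simp: inj_on_def)
  ultimately have finJ: "finite J" using finU finite_imageD finite_subset by blast
  have "adj (x + int n, y) (x + int (Suc n), y)" by (simp add: adj_pair)
  then have nJ: "Suc n \<in> J" using assms(4) unfolding J_def nbh_def by blast
  define j where "j = Max J"
  have j: "j \<in> J" "Suc n \<le> j" using finJ nJ Max_in Max_ge unfolding j_def by (blast, simp)
  have beyond: "(x + int i, y) \<notin> ?U" if "j < i" for i
    using Max_ge[OF finJ, of i] that unfolding j_def J_def by force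
  define e where "e = ((x + int j, y), (x + int j + 1, y))"
  have e: "e \<in> bdry ?U"
    using j(1) beyond[of "Suc j"] unfolding e_def bdry_def J_def by (simp add: adj_pair algebra_simps)
  define \<Gamma> where "\<Gamma> = range (contour ?U e)"
  have sub: "\<Gamma> \<subseteq> bdry ?U" using e contour_range_subset unfolding \<Gamma>_def by blast
  have fin: "finite \<Gamma>" using sub finite_bdry[OF finU] finite_subset by blast
  have st: "step ?U ` \<Gamma> = \<Gamma>" using step_orbit[OF e] fin unfolding \<Gamma>_def by blast
  note G = fin sub st
  have "e \<in> \<Gamma>" using rangeI[of "contour ?U e" 0] by (simp add: \<Gamma>_def)
  \<comment> \<open>Beyond column \<open>x + int j\<close> the row avoids \<open>nbh A\<close>, so
    the ray meets the contour only in its starting edge.\<close>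
  have "hray \<Gamma> (x + int j, y) = {x + int j}"
  proof -
    have "crosses \<Gamma> (x + int j, y) (x + int j + 1, y)" using \<open>e \<in> \<Gamma>\<close> by (simp add: crosses_def e_def)
    moreover have "\<not> crosses \<Gamma> (i, y) (i + 1, y)" if "x + int j < i" for i
    proof
      assume "crosses \<Gamma> (i, y) (i + 1, y)"
      then have "(i, y) \<in> ?U \<or> (i + 1, y) \<in> ?U" using crosses_bdry[OF sub] by blast
      then show False using beyond[of "nat (i - x)"] beyond[of "nat (i + 1 - x)"] that by simp
    qed
    ultimately show ?thesis by (auto simp: hray_def) (metis order_le_less)
  qed
  then have "side \<Gamma> (x + int j, y)" by (simp add: side_def)
  moreover have const: "side \<Gamma> a = side \<Gamma> (x, y)" if aU: "a \<in> ?U" for a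
  proof -
    obtain a' where a': "a' \<in> A" "a = a' \<or> adj a' a" using aU unfolding nbh_def by blast
    then have "side \<Gamma> a' = side \<Gamma> a"
      using side_adj[OF G, of a' a] crosses_bdry[OF sub, of a' a] that subset_nbh[of A] by blast
    then show ?thesis using side_const[OF G, of A] a' assms(3) by blast
  qed
  ultimately have s0: "side \<Gamma> (x, y)" using j(1) by (auto simp: J_def)
  have "\<exists>i::nat. \<not> side \<Gamma> (x - int i, y)"
  proof (rule ccontr)
    assume "\<not> ?thesis"
    then have "(\<lambda>i. (x - int i, y)) ` UNIV \<subseteq> {u. side \<Gamma> u}" by auto
    moreover have "inj (\<lambda>i::nat. (x - int i, y))" by (auto simp: inj_def)
    ultimately show False using side_far[OF G] finite_imageD finite_subset infinite_UNIV_nat by blast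
  qed
  then obtain i where i: "\<not> side \<Gamma> (x - int i, y)" by blast
  have "\<exists>k<i. side \<Gamma> (x - int k, y) \<and> \<not> side \<Gamma> (x - int (Suc k), y)"
  proof (rule ccontr)
    assume no: "\<not> ?thesis"
    have "k \<le> i \<Longrightarrow> side \<Gamma> (x - int k, y)" for k
      by (induction k) (use s0 no in \<open>auto simp: Suc_le_eq\<close>)
    then show False using i by blast
  qed
  then obtain k where "side \<Gamma> (x - int k, y)" "\<not> side \<Gamma> (x - int (Suc k), y)" by blast
  moreover have "adj (x - int k, y) (x - int (Suc k), y)" by (simp add: adj_pair)
  ultimately have "crosses \<Gamma> (x - int k, y) (x - int (Suc k), y)" using side_adj[OF G] by blast
  then obtain m where m: "fst (fst (contour ?U e m)) \<le> x"
    unfolding crosses_def \<Gamma>_def by (auto simp: image_iff) (metis fst_conv diff_le_eq le_add_same_cancel1 of_nat_0_le_iff add_increasing zero_le_one)+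
  \<comment> \<open>The sign is reversed because the intermediate value theorem for integer
    sequences wants the smaller value at the start.\<close>
  define f where "f i = - fst (fst (contour ?U e i))" for i
  have "{x + 1 .. x + int j} \<subseteq> fst ` inner_sites ?U e m"
  proof
    fix t assume t: "t \<in> {x + 1 .. x + int j}"
    have "\<exists>i\<ge>0. i \<le> m \<and> f i = - t"
    proof (rule nat_intermed_int_val)
      show "\<forall>i. 0 \<le> i \<and> i < m \<longrightarrow> \<bar>f (Suc i) - f i\<bar> \<le> 1"
        using step_fst_close[OF contour_bdry[OF e]] by (auto simp: f_def contour_Suc abs_minus_commute)
    qed (use t m in \<open>auto simp: f_def e_def\<close>)
    then show "t \<in> fst ` inner_sites ?U e m" by (force simp: f_def inner_sites_def image_iff)
  qed
  then have "card {x + 1 .. x + int j} \<le> card (fst ` inner_sites ?U e m)"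
    by (intro card_mono) auto
  also have "\<dots> \<le> card (inner_sites ?U e m)" by (rule card_image_le) simp
  finally have "j \<le> card (inner_sites ?U e m)" by simp
  then show thesis using that[of j m] j e unfolding e_def by simp
qed

lemma adj_connected: "(u, v) \<in> {(a, b). adj a b}\<^sup>*"
proof -
  let ?R = "{(a, b). adj a b}"
  have s: "sym (?R\<^sup>*)" by (rule sym_rtrancl) (auto simp: sym_def adj_sym)
  have h: "((x, y), (x + int k, y)) \<in> ?R\<^sup>*" for x y k
  proof (induction k)
    case (Suc k)
    have "adj (x + int k, y) (x + int (Suc k), y)" by (simp add: adj_pair)
    then show ?case using Suc by (auto intro: rtrancl_into_rtrancl)
  qed simp
  have w: "((x, y), (x, y + int k)) \<in> ?R\<^sup>*" for x y k
  proof (induction k)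
    case (Suc k)
    have "adj (x, y + int k) (x, y + int (Suc k))" by (simp add: adj_pair)
    then show ?case using Suc by (auto intro: rtrancl_into_rtrancl)
  qed simp
  have h': "((x, y), (x', y)) \<in> ?R\<^sup>*" for x x' y
    using h[of x y "nat (x' - x)"] h[of x' y "nat (x - x')"] s by (cases "x \<le> x'") (auto dest: symD)
  have w': "((x, y), (x, y')) \<in> ?R\<^sup>*" for x y y'
    using w[of x y "nat (y' - y)"] w[of x y' "nat (y - y')"] s by (cases "y \<le> y'") (auto dest: symD)
  obtain a b c d where "u = (a, b)" "v = (c, d)" by (cases u; cases v) 
  then show ?thesis using h'[of a b c] w'[of c b d] by auto
qed

text \<open>The contours met by a path joining the two sets are finitely many finite cycles, so their
  union separates no two infinite connected sets; but the path crosses the boundary an odd number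
  of times.\<close>

lemma no_two_infinite:
  assumes A: "infinite A" "v \<in> A" "\<And>a. a \<in> A \<Longrightarrow> (v, a) \<in> (links A)\<^sup>*"
    and B: "infinite B" "w \<in> B" "\<And>b. b \<in> B \<Longrightarrow> (w, b) \<in> (links B)\<^sup>*"
    and disj: "nbh A \<inter> nbh B = {}"
    and fin: "\<And>e. e \<in> bdry (nbh A) \<Longrightarrow> finite (range (contour (nbh A) e))"
  shows False
proof -
  let ?U = "nbh A"
  obtain n where "(v, w) \<in> {(a, b). adj a b} ^^ n" using adj_connected rtrancl_imp_relpow by blast
  then obtain f where f: "f 0 = v" "f n = w" "\<And>i. i < n \<Longrightarrow> adj (f i) (f (Suc i))"
    by (auto simp: relpow_fun_conv)
  define E where "E = bdry ?U \<inter> (f ` {..n} \<times> f ` {..n})"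
  have finE: "finite E" by (simp add: E_def)
  define \<Gamma> where "\<Gamma> = (\<Union>e\<in>E. range (contour ?U e))"
  have "\<Gamma> \<subseteq> bdry ?U" using contour_range_subset unfolding \<Gamma>_def E_def by blast
  moreover have "finite \<Gamma>" using finE fin unfolding \<Gamma>_def E_def by blast
  moreover have "step ?U ` \<Gamma> = \<Gamma>"
    unfolding \<Gamma>_def image_UN using step_orbit fin by (intro SUP_cong) (auto simp: E_def)
  ultimately have G: "finite \<Gamma>" "\<Gamma> \<subseteq> bdry ?U" "step ?U ` \<Gamma> = \<Gamma>" by auto
  have E\<Gamma>: "E \<subseteq> \<Gamma>" unfolding \<Gamma>_def using rangeI[of "contour ?U _" 0] by fastforce
  \<comment> \<open>Along the path, \<open>side\<close> and membership in \<open>nbh A\<close>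
    change together, since every boundary edge on the path belongs to
    \<open>\<Gamma>\<close>.\<close>
  have "i \<le> n \<Longrightarrow> (side \<Gamma> (f i) \<noteq> (f i \<in> ?U)) = (side \<Gamma> v \<noteq> (v \<in> ?U))" for i
  proof (induction i)
    case (Suc i)
    have a: "adj (f i) (f (Suc i))" using f Suc by simp
    have "crosses \<Gamma> (f i) (f (Suc i)) \<longleftrightarrow> ((f i \<in> ?U) \<noteq> (f (Suc i) \<in> ?U))"
    proof
      assume *: "(f i \<in> ?U) \<noteq> (f (Suc i) \<in> ?U)"
      have "(f i, f (Suc i)) \<in> E \<or> (f (Suc i), f i) \<in> E"
        using * a adj_sym_imp[OF a] Suc.prems unfolding E_def bdry_def by auto
      then show "crosses \<Gamma> (f i) (f (Suc i))" using E\<Gamma> by (auto simp: crosses_def)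
    qed (rule crosses_bdry[OF G(2)])
    then show ?case using side_adj[OF G a] Suc by auto
  qed (simp add: f)
  from this[of n] have 1: "(side \<Gamma> w \<noteq> (w \<in> ?U)) = (side \<Gamma> v \<noteq> (v \<in> ?U))" using f by simp
  have "w \<notin> ?U" "v \<in> ?U" using A B disj subset_nbh by blast+
  moreover have "\<not> side \<Gamma> v"
  proof
    assume "side \<Gamma> v"
    then have "A \<subseteq> {u. side \<Gamma> u}" using side_const[OF G, of A v] A by blast
    then show False using side_far[OF G] A finite_subset by blast
  qed
  moreover have "\<not> side \<Gamma> w"
  proof
    assume "side \<Gamma> w"
    then have "B \<subseteq> {u. side \<Gamma> u}" using side_const[OF G, of B w] B disj by blast
    then show False using side_far[OF G] B finite_subset by blast
  qed
  ultimately show False using 1 by blast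
qed

subsection \<open>The Peierls bound\<close>

definition pt :: "int \<times> int \<Rightarrow> complex" where
  "pt v = of_int (fst v) + of_int (snd v) * exp (\<i> * of_real pi / 3)"

lemma exp_pi_third: "exp (\<i> * of_real pi / 3) = Complex (1/2) (sqrt 3 / 2)"
proof -
  have "\<i> * of_real pi / 3 = \<i> * of_real (pi / 3)" by simp
  then have "exp (\<i> * of_real pi / 3) = cis (pi / 3)" by (simp only: cis_conv_exp)
  then show ?thesis by (simp add: complex_eq_iff cos_60 sin_60)
qed

lemma pt_Complex: "pt v = Complex (of_int (fst v) + of_int (snd v) / 2) (of_int (snd v) * sqrt 3 / 2)"
  by (simp add: pt_def exp_pi_third complex_eq_iff)

lemma inj_pt: "inj pt"
  by (rule injI) (simp add: pt_Complex prod_eq_iff)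

lemma pt_eq_iff [simp]: "pt u = pt v \<longleftrightarrow> u = v"
  using inj_pt by (auto dest: injD)

lemma sites_eq: "sites = range pt"
  by (force simp: sites_def pt_def image_iff)

lemma pt_sites [simp]: "pt v \<in> sites"
  by (simp add: sites_eq)

text \<open>\<open>A\<close> is a union of components of the open sites after the finite set \<open>B\<close> has been set aside: its
  status in \<open>\<eta>\<close> is ignored, so that it can carry a prescribed pattern.\<close>

definition thick :: "(int \<times> int) set \<Rightarrow> (int \<times> int \<Rightarrow> bool) \<Rightarrow> (int \<times> int) set \<Rightarrow> bool" where
  "thick B \<eta> A \<longleftrightarrow> nbh B \<subseteq> nbh A \<and> (\<forall>x\<in>nbh (nbh A). x \<notin> A \<longrightarrow> x \<notin> B \<longrightarrow> \<not> \<eta> x) \<and> (\<forall>a\<in>A. a \<notin> B \<longrightarrow> \<eta> a)"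

text \<open>Since \<open>w\<close> is outside \<open>nbh A\<close>, its neighbour \<open>b\<close>
  is next to \<open>A\<close> but not in it; both ends are thus outside \<open>A\<close> and within
  two steps of it. The inclusion \<open>nbh B \<subseteq> nbh A\<close> keeps them out of
  \<open>B\<close>, where a site may be open.\<close>

lemma thick_bdry:
  assumes "thick B \<eta> A" "(b, w) \<in> bdry (nbh A)"
  shows "\<not> \<eta> b" "\<not> \<eta> w" "b \<notin> nbh B \<Longrightarrow> \<exists>a. adj b a \<and> \<eta> a"
proof -
  have bw: "adj b w" "b \<in> nbh A" "w \<notin> nbh A" using assms(2) by (auto simp: bdry_def)
  have "b \<notin> A" "w \<notin> A" using bw subset_nbh by (auto simp: nbh_def)
  moreover have "b \<notin> B" "w \<notin> B" using bw assms(1) subset_nbh[of B] by (auto simp: nbh_def thick_def)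
  moreover have "b \<in> nbh (nbh A)" "w \<in> nbh (nbh A)" using bw unfolding nbh_def[of "nbh A"] by blast+
  ultimately show "\<not> \<eta> b" "\<not> \<eta> w" using assms(1) unfolding thick_def by blast+
  assume nb: "b \<notin> nbh B"
  obtain a where a: "a \<in> A" "adj a b" using bw \<open>b \<notin> A\<close> unfolding nbh_def by blast
  then have "a \<notin> B" using nb by (auto simp: nbh_def)
  then show "\<exists>a. adj b a \<and> \<eta> a" using a assms(1) adj_sym unfolding thick_def by blast
qed

section \<open>The product measure in integer coordinates\<close>

abbreviation perc :: "(complex \<Rightarrow> bool) measure" where
  "perc \<equiv> site_percolation (1/2)"

lemma product_prob_space_bernoulli: "product_prob_space (\<lambda>_::complex. measure_pmf (bernoulli_pmf p))"
  by (simp add: product_prob_spaceI prob_space_measure_pmf)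

interpretation perc: prob_space perc
  unfolding site_percolation_def by (intro prob_space_PiM prob_space_measure_pmf)

definition event :: "((int \<times> int \<Rightarrow> bool) \<Rightarrow> bool) \<Rightarrow> (complex \<Rightarrow> bool) set" where
  "event P = {\<omega> \<in> space perc. P (\<lambda>v. \<omega> (pt v))}"

lemma event_mono: "(\<And>\<eta>. P \<eta> \<Longrightarrow> Q \<eta>) \<Longrightarrow> event P \<subseteq> event Q"
  by (auto simp: event_def)

lemma site_measurable [measurable]: "(\<lambda>\<omega>. \<omega> (pt v)) \<in> measurable perc (count_space UNIV)"
proof -
  have "(\<lambda>\<omega>. \<omega> (pt v)) \<in> measurable perc (measure_pmf (bernoulli_pmf (1/2)))"
    unfolding site_percolation_def by (rule measurable_component_singleton) simp
  then show ?thesis by simp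
qed

lemma prob_pattern:
  assumes "finite X"
  shows "event (\<lambda>\<eta>. \<forall>x\<in>X. \<eta> x = c x) \<in> sets perc"
    and "perc.prob (event (\<lambda>\<eta>. \<forall>x\<in>X. \<eta> x = c x)) = (1/2) ^ card X"
proof -
  interpret P: product_prob_space "\<lambda>_::complex. measure_pmf (bernoulli_pmf (1/2))" sites
    by (rule product_prob_space_bernoulli)
  have "Measurable.pred perc (\<lambda>\<omega>. \<omega> (pt x) = c x)" for x
    by (cases "c x") simp_all
  then show "event (\<lambda>\<eta>. \<forall>x\<in>X. \<eta> x = c x) \<in> sets perc"
    unfolding event_def using assms by measurable
  have "event (\<lambda>\<eta>. \<forall>x\<in>X. \<eta> x = c x) = {\<omega> \<in> space perc. \<forall>z\<in>pt ` X. \<omega> z \<in> {c (the_inv pt z)}}"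
    by (auto simp: event_def the_inv_f_f[OF inj_pt])
  moreover have "emeasure perc \<dots> = (\<Prod>z\<in>pt ` X. emeasure (measure_pmf (bernoulli_pmf (1/2))) {c (the_inv pt z)})"
    unfolding site_percolation_def by (rule P.emeasure_PiM_Collect) (use assms in auto)
  moreover have "emeasure (measure_pmf (bernoulli_pmf (1/2))) {b} = ennreal (1/2)" for b
    by (cases b) (simp_all add: emeasure_pmf_single)
  moreover have "card (pt ` X) = card X" by (rule card_image) (auto simp: inj_on_def)
  ultimately have "emeasure perc (event (\<lambda>\<eta>. \<forall>x\<in>X. \<eta> x = c x)) = ennreal (1/2) ^ card X" by simp
  also have "\<dots> = ennreal ((1/2) ^ card X)" by (rule ennreal_power) simp
  finally show "perc.prob (event (\<lambda>\<eta>. \<forall>x\<in>X. \<eta> x = c x)) = (1/2) ^ card X"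
    by (simp add: measure_def)
qed

text \<open>Avoiding one more block subtracts the event that this block shows the pattern too, which
  is an event of the same form with the block added to \<open>X\<close>. A single colouring
  \<open>c\<close> for all blocks keeps the form stable under this induction.\<close>

lemma prob_pattern_avoid:
  assumes "finite S" "finite X" "\<And>s. s \<in> S \<Longrightarrow> finite (N s)" "\<And>s. s \<in> S \<Longrightarrow> N s \<inter> X = {}"
    and "\<And>s t. s \<in> S \<Longrightarrow> t \<in> S \<Longrightarrow> s \<noteq> t \<Longrightarrow> N s \<inter> N t = {}"
  shows "event (\<lambda>\<eta>. (\<forall>x\<in>X. \<eta> x = c x) \<and> (\<forall>s\<in>S. \<not> (\<forall>x\<in>N s. \<eta> x = c x))) \<in> sets perc \<and>
    perc.prob (event (\<lambda>\<eta>. (\<forall>x\<in>X. \<eta> x = c x) \<and> (\<forall>s\<in>S. \<not> (\<forall>x\<in>N s. \<eta> x = c x))))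
      = (1/2) ^ card X * (\<Prod>s\<in>S. 1 - (1/2) ^ card (N s))"
  using assms
proof (induction S arbitrary: X rule: finite_induct)
  case empty then show ?case using prob_pattern by simp
next
  case (insert t S)
  let ?E = "\<lambda>X. event (\<lambda>\<eta>. (\<forall>x\<in>X. \<eta> x = c x) \<and> (\<forall>s\<in>S. \<not> (\<forall>x\<in>N s. \<eta> x = c x)))"
  have E: "?E Y \<in> sets perc \<and> perc.prob (?E Y) = (1/2) ^ card Y * (\<Prod>s\<in>S. 1 - (1/2) ^ card (N s))"
    if "Y = X \<or> Y = X \<union> N t" for Y
  proof (rule insert.IH)
    show "finite Y" using that insert.prems by auto
    show "N s \<inter> Y = {}" if "s \<in> S" for s
      using \<open>Y = X \<or> Y = X \<union> N t\<close> insert.prems(3)[of s] insert.prems(4)[of s t] insert.hyps that by blast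
  qed (use insert.prems in simp_all)
  have *: "event (\<lambda>\<eta>. (\<forall>x\<in>X. \<eta> x = c x) \<and> (\<forall>s\<in>insert t S. \<not> (\<forall>x\<in>N s. \<eta> x = c x))) = ?E X - ?E (X \<union> N t)"
    unfolding event_def by auto
  have "card (X \<union> N t) = card X + card (N t)"
    using insert by (intro card_Un_disjoint) auto
  moreover have "?E (X \<union> N t) \<subseteq> ?E X" by (rule event_mono) auto
  ultimately have "perc.prob (?E X - ?E (X \<union> N t)) =
     (1/2) ^ card X * (\<Prod>s\<in>S. 1 - (1/2) ^ card (N s)) - (1/2) ^ (card X + card (N t)) * (\<Prod>s\<in>S. 1 - (1/2) ^ card (N s))"
    using E by (subst perc.finite_measure_Diff) auto
  also have "\<dots> = (1/2) ^ card X * (\<Prod>s\<in>insert t S. 1 - (1/2) ^ card (N s))"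
    using insert.hyps by (simp add: power_add algebra_simps)
  finally show ?case unfolding * using E by auto
qed

text \<open>A union bound without counting: the \<open>F i\<close> are disjoint, so their
  probabilities add up to at most 1. The index set is moved to the natural numbers, with empty sets
  as padding.\<close>

lemma (in prob_space) prob_UN_le:
  assumes "countable I" "r \<ge> 0" "\<And>i. i \<in> I \<Longrightarrow> E i \<in> events" "\<And>i. i \<in> I \<Longrightarrow> F i \<in> events"
    and "disjoint_family_on F I" "\<And>i. i \<in> I \<Longrightarrow> prob (E i) \<le> r * prob (F i)"
  shows "prob (\<Union>i\<in>I. E i) \<le> r"
proof -
  define g where "g = to_nat_on I"
  have g: "inj_on g I" using assms(1) by (simp add: g_def inj_on_to_nat_on)
  define E' where "E' n = (\<Union>i\<in>{i\<in>I. g i = n}. E i)" for n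
  define F' where "F' n = (\<Union>i\<in>{i\<in>I. g i = n}. F i)" for n
  have *: "E' n \<in> events \<and> F' n \<in> events \<and> prob (E' n) \<le> r * prob (F' n)" for n
  proof (cases "n \<in> g ` I")
    case True
    then obtain i where i: "i \<in> I" "n = g i" by blast
    then have "{j \<in> I. g j = n} = {i}" using g by (auto dest: inj_onD)
    then show ?thesis using assms i by (simp add: E'_def F'_def)
  next
    case False
    then have "{j \<in> I. g j = n} = {}" by blast
    then show ?thesis by (simp only: E'_def F'_def) simp
  qed
  then have E': "E' n \<in> events" and F': "F' n \<in> events" and le: "prob (E' n) \<le> r * prob (F' n)" for n
    by simp_all
  have "disjoint_family F'"
    unfolding disjoint_family_on_def
  proof (intro ballI impI)
    fix m n :: nat assume "m \<noteq> n"
    then have "F i \<inter> F j = {}" if "i \<in> I" "g i = m" "j \<in> I" "g j = n" for i j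
      using disjoint_family_onD[OF assms(5), of i j] that by blast
    then show "F' m \<inter> F' n = {}" unfolding F'_def by blast
  qed
  then have "(\<lambda>n. prob (F' n)) sums prob (\<Union>n. F' n)"
    using F' by (intro finite_measure_UNION) auto
  then have s: "(\<lambda>n. r * prob (F' n)) sums (r * prob (\<Union>n. F' n))" by (rule sums_mult)
  then have sE: "summable (\<lambda>n. prob (E' n))"
    using le by (intro summable_comparison_test'[OF sums_summable[OF s], of 0]) simp
  have "(\<Union>i\<in>I. E i) = (\<Union>n. E' n)" by (auto simp: E'_def)
  then have "prob (\<Union>i\<in>I. E i) \<le> (\<Sum>n. prob (E' n))"
    using finite_measure_subadditive_countably[of E'] E' sE by auto
  also have "\<dots> \<le> (\<Sum>n. r * prob (F' n))" by (rule suminf_le[OF le sE sums_summable[OF s]])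
  also have "\<dots> = r * prob (\<Union>n. F' n)" by (rule sums_unique[OF s, symmetric])
  also have "\<dots> \<le> r * 1" using assms(2) by (intro mult_left_mono) auto
  finally show ?thesis by simp
qed

text \<open>At most six neighbours fail to be all closed with probability at most 63/64, and for at
  least one inner site in nine these failures are independent. The ninth root spreads the gain over
  all inner sites.\<close>

definition rho :: real where "rho = root 9 (63/64)"

lemma rho: "rho ^ 9 = 63/64" "1/2 \<le> rho" "rho < 1"
proof -
  show r: "rho ^ 9 = 63/64" by (simp add: rho_def)
  show "rho < 1" by (simp add: rho_def)
  have "root 9 ((1/2)^9) \<le> rho" unfolding rho_def by (subst real_root_le_iff) (simp_all add: power_one_over)
  then show "1/2 \<le> rho" by (subst (asm) real_root_power_cancel) simp_all
qed

definition residue_class :: "int \<times> int \<Rightarrow> int \<times> int" where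
  "residue_class u = (fst u mod 3, snd u mod 3)"

text \<open>Sites with a common neighbour differ by at most 2 in each coordinate.\<close>

lemma residue_class_disjoint:
  assumes "residue_class u = residue_class v" "adj u a" "adj v a" shows "u = v"
proof -
  obtain x y where u: "u = (x, y)" by fastforce
  obtain x' y' where v: "v = (x', y')" by fastforce
  obtain p q where a: "a = (p, q)" by fastforce
  have "\<bar>p - x\<bar> \<le> 1" "\<bar>q - y\<bar> \<le> 1" "\<bar>p - x'\<bar> \<le> 1" "\<bar>q - y'\<bar> \<le> 1"
    using assms(2,3) unfolding u v a adj_pair by auto
  moreover have "3 dvd x - x'" "3 dvd y - y'" using assms(1) by (auto simp: residue_class_def u v mod_eq_dvd_iff)
  then have "x = x' \<or> 3 \<le> \<bar>x - x'\<bar>" "y = y' \<or> 3 \<le> \<bar>y - y'\<bar>"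
    using dvd_imp_le_int[of "x - x'" 3] dvd_imp_le_int[of "y - y'" 3] by auto
  ultimately have "x = x'" "y = y'" by linarith+
  then show ?thesis by (simp add: u v)
qed

lemma large_residue_class:
  assumes "finite I"
  obtains r where "card I \<le> 9 * card {u \<in> I. residue_class u = r}"
proof -
  let ?R = "{0..2::int} \<times> {0..2::int}"
  have sub: "residue_class u \<in> ?R" for u
    using pos_mod_bound[of 3 "fst u"] pos_mod_bound[of 3 "snd u"] by (auto simp: residue_class_def)
  have "\<exists>r\<in>?R. card I \<le> 9 * card {u \<in> I. residue_class u = r}"
  proof (rule ccontr)
    assume "\<not> ?thesis"
    then have less: "\<And>r. r \<in> ?R \<Longrightarrow> 9 * card {u \<in> I. residue_class u = r} < card I" by force
    have "card I = (\<Sum>r\<in>?R. card {u \<in> I. residue_class u = r})"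
      using sum.group[of I ?R residue_class "\<lambda>_. 1::nat"] assms sub by (auto simp: image_subset_iff)
    then have "9 * card I = (\<Sum>r\<in>?R. 9 * card {u \<in> I. residue_class u = r})" by (simp only: sum_distrib_left)
    also have "\<dots> < (\<Sum>r\<in>?R. card I)" using less by (intro sum_strict_mono) auto
    finally show False by simp
  qed
  then show ?thesis using that by blast
qed

text \<open>\<open>E\<close> is the event that \<open>(I, O')\<close> bounds a thick set, \<open>F\<close> the auxiliary fair colouring in which the
  sites of \<open>nbh B\<close> are not coloured at random but taken to be inside.\<close>

lemma prob_code:
  fixes B I O' :: "(int \<times> int) set" and c :: "int \<times> int \<Rightarrow> bool"
  defines "c' \<equiv> \<lambda>x. x \<in> B \<and> c x"
  defines "E \<equiv> event (\<lambda>\<eta>. (\<forall>x\<in>B \<union> I \<union> O'. \<eta> x = c' x) \<and>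
     (\<forall>b\<in>I - nbh B. \<not> (\<forall>x\<in>{a. adj b a} - (I \<union> O'). \<eta> x = c' x)))"
  defines "F \<equiv> event (\<lambda>\<eta>. \<forall>x\<in>(I - nbh B) \<union> O'. \<eta> x = (x \<in> I))"
  assumes fin: "finite B" "finite I" "finite O'" and disj: "I \<inter> O' = {}" "(I \<union> O') \<inter> B = {}"
    and d: "d \<le> card I"
  shows "E \<in> sets perc" "F \<in> sets perc" "perc.prob E \<le> (1/2) ^ card B * rho ^ d * perc.prob F"
proof -
  have "Measurable.pred perc (\<lambda>\<omega>. \<omega> (pt x) = c' x)" for x by (cases "c' x") simp_all
  then show "E \<in> sets perc"
    unfolding E_def event_def using fin finite_adj by measurable
  have F: "F \<in> sets perc" "perc.prob F = (1/2) ^ card ((I - nbh B) \<union> O')"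
    unfolding F_def using fin by (intro prob_pattern; simp)+
  then show "F \<in> sets perc" by simp
  let ?J = "I - nbh B"
  \<comment> \<open>Within one residue class the sets \<open>N b\<close> are disjoint; the price is
    a factor 9 in the number of sites.\<close>
  obtain r where r: "card ?J \<le> 9 * card {u \<in> ?J. residue_class u = r}"
    using large_residue_class[of ?J] fin by auto
  define S where "S = {u \<in> ?J. residue_class u = r}"
  define N where "N b = {a. adj b a} - (I \<union> O')" for b
  define G where "G = event (\<lambda>\<eta>. (\<forall>x\<in>B \<union> I \<union> O'. \<eta> x = c' x) \<and> (\<forall>s\<in>S. \<not> (\<forall>x\<in>N s. \<eta> x = c' x)))"
  have G: "G \<in> sets perc \<and> perc.prob G = (1/2) ^ card (B \<union> I \<union> O') * (\<Prod>s\<in>S. 1 - (1/2) ^ card (N s))"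
    unfolding G_def
  proof (rule prob_pattern_avoid)
    show "finite S" "finite (B \<union> I \<union> O')" "\<And>s. finite (N s)"
      using fin finite_adj by (auto simp: S_def N_def)
    show "N s \<inter> (B \<union> I \<union> O') = {}" if "s \<in> S" for s
      using that adj_sym by (auto simp: S_def N_def nbh_def)
    show "N s \<inter> N t = {}" if "s \<in> S" "t \<in> S" "s \<noteq> t" for s t
      using that residue_class_disjoint[of s t] by (auto simp: S_def N_def)
  qed
  have "perc.prob E \<le> perc.prob G"
  proof (rule perc.finite_measure_mono)
    show "E \<subseteq> G" unfolding E_def G_def by (rule event_mono) (auto simp: S_def N_def)
  qed (use G in simp)
  also have "\<dots> \<le> (1/2) ^ card (B \<union> I \<union> O') * (63/64) ^ card S"
  proof -
    have "(\<Prod>s\<in>S. 1 - (1/2) ^ card (N s)) \<le> (\<Prod>s\<in>S. 63/64 :: real)"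
    proof (rule prod_mono)
      fix s assume "s \<in> S"
      have "card (N s) \<le> card {a. adj s a}" unfolding N_def by (intro card_mono finite_adj) auto
      then have "card (N s) \<le> 6" using card_adj[of s] by simp
      then have "(1/2::real) ^ 6 \<le> (1/2) ^ card (N s)" by (intro power_decreasing) auto
      moreover have "(1/2::real) ^ card (N s) \<le> 1" by (intro power_le_one) auto
      ultimately show "0 \<le> 1 - (1/2::real) ^ card (N s) \<and> 1 - (1/2::real) ^ card (N s) \<le> 63/64"
        by (simp add: power_one_over[of 2 6] del: power_one_over)
    qed
    then show ?thesis using G by (simp add: mult_left_mono)
  qed
  also have "(63/64 :: real) ^ card S = rho ^ (9 * card S)" by (simp add: power_mult rho(1))
  also have "\<dots> \<le> rho ^ card ?J" using r rho by (intro power_decreasing) (auto simp: S_def)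
  \<comment> \<open>The part \<open>?J \<union> O'\<close> gives the probability of
    \<open>F\<close>. The sites of \<open>I \<inter> nbh B\<close> carry no condition on open
    neighbours, but \<open>F\<close> does not colour them either, so each keeps a factor 1/2, which
    is at most \<open>rho\<close>.\<close>
  also have "(1/2::real) ^ card (B \<union> I \<union> O') = (1/2) ^ card B * ((1/2) ^ card (I \<inter> nbh B) * (1/2) ^ card (?J \<union> O'))"
  proof -
    have "B \<union> I \<union> O' = B \<union> ((I \<inter> nbh B) \<union> (?J \<union> O'))" by auto
    moreover have "card \<dots> = card B + card ((I \<inter> nbh B) \<union> (?J \<union> O'))"
      using fin disj by (intro card_Un_disjoint) auto
    moreover have "card ((I \<inter> nbh B) \<union> (?J \<union> O')) = card (I \<inter> nbh B) + card (?J \<union> O')"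
      using fin disj by (intro card_Un_disjoint) auto
    ultimately show ?thesis by (simp only: power_add)
  qed
  also have "(1/2) ^ card B * ((1/2) ^ card (I \<inter> nbh B) * (1/2) ^ card (?J \<union> O')) * rho ^ card ?J
     = (1/2) ^ card B * ((1/2) ^ card (I \<inter> nbh B) * rho ^ card ?J) * (1/2) ^ card (?J \<union> O')"
    by (simp only: mult_ac)
  also have "\<dots> \<le> (1/2) ^ card B * rho ^ d * (1/2) ^ card (?J \<union> O')"
  proof -
    have "(1/2) ^ card (I \<inter> nbh B) * rho ^ card ?J \<le> rho ^ card (I \<inter> nbh B) * rho ^ card ?J"
      using rho by (intro mult_right_mono power_mono) auto
    also have "\<dots> = rho ^ card I"
      using card_Un_disjoint[of "I \<inter> nbh B" ?J] fin by (simp add: power_add[symmetric] Int_Diff_Un Int_Diff_disjoint)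
    also have "\<dots> \<le> rho ^ d" using d rho by (intro power_decreasing) auto
    finally show ?thesis by (intro mult_right_mono mult_left_mono) auto
  qed
  finally show "perc.prob E \<le> (1/2) ^ card B * rho ^ d * perc.prob F"
    using F by (simp add: mult_left_mono mult_right_mono)
qed

text \<open>The record stops at the first index with \<open>d\<close> inner sites. This index can be
  read off the traced contour, so a colouring cannot be consistent with two records. Here
  \<open>U\<close> ranges over arbitrary sets, so that the family does not depend on the
  configuration.\<close>

definition codes :: "(int \<times> int) set \<Rightarrow> (int \<times> int) \<times> (int \<times> int) \<Rightarrow> nat \<Rightarrow> ((int \<times> int) set \<times> (int \<times> int) set) set" where
  "codes B e d = {(inner_sites U e m, outer_sites U e m) | U m. nbh B \<subseteq> U \<and> e \<in> bdry U \<and>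
     d \<le> card (inner_sites U e m) \<and> (\<forall>k<m. card (inner_sites U e k) < d)}"

lemma codesE:
  assumes "(I, O') \<in> codes B e d"
  obtains U m where "nbh B \<subseteq> U" "e \<in> bdry U" "I = inner_sites U e m" "O' = outer_sites U e m"
     "d \<le> card I" "\<And>k. k < m \<Longrightarrow> card (inner_sites U e k) < d" "I \<subseteq> U" "O' \<inter> U = {}"
proof -
  obtain U m where "I = inner_sites U e m" "O' = outer_sites U e m" "nbh B \<subseteq> U" "e \<in> bdry U"
    "d \<le> card I" "\<And>k. k < m \<Longrightarrow> card (inner_sites U e k) < d"
    using assms unfolding codes_def by auto
  then show thesis using that[of U m] inner_subset[of e U m] outer_subset[of e U m] by simp
qed

lemma inner_sites_bdry:
  assumes "e \<in> bdry U" "b \<in> inner_sites U e m" obtains w where "(b, w) \<in> bdry U" "w \<in> outer_sites U e m"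
proof -
  obtain i where i: "i \<le> m" "b = fst (contour U e i)" using assms(2) by (auto simp: inner_sites_def)
  show ?thesis
  proof (rule that[of "snd (contour U e i)"])
    show "(b, snd (contour U e i)) \<in> bdry U" using contour_bdry[OF assms(1), of i] i by simp
    show "snd (contour U e i) \<in> outer_sites U e m" using i by (auto simp: outer_sites_def)
  qed
qed

lemma outer_sites_bdry:
  assumes "e \<in> bdry U" "w \<in> outer_sites U e m" obtains b where "(b, w) \<in> bdry U"
proof -
  obtain i where i: "i \<le> m" "w = snd (contour U e i)" using assms(2) by (auto simp: outer_sites_def)
  show ?thesis
    by (rule that[of "fst (contour U e i)"]) (use contour_bdry[OF assms(1), of i] i in simp)
qed

lemma codes_disjoint:
  assumes "(I, O') \<in> codes B e d"
  shows "finite I" "finite O'" "I \<inter> O' = {}" "(I \<union> O') \<inter> B = {}" "d \<le> card I"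
proof -
  obtain U m where U: "nbh B \<subseteq> U" "e \<in> bdry U" "I = inner_sites U e m" "O' = outer_sites U e m"
     "d \<le> card I" "I \<subseteq> U" "O' \<inter> U = {}" using codesE[OF assms] by metis
  show "finite I" "finite O'" "d \<le> card I" "I \<inter> O' = {}" using U by auto
  have "b \<notin> B" if "b \<in> I" for b
  proof
    assume "b \<in> B"
    obtain w where "(b, w) \<in> bdry U" using inner_sites_bdry[OF U(2)] \<open>b \<in> I\<close> U(3) by blast
    then show False using U(1) \<open>b \<in> B\<close> by (auto simp: bdry_def nbh_def)
  qed
  moreover have "O' \<inter> B = {}" using U(1,7) subset_nbh[of B] by blast
  ultimately show "(I \<union> O') \<inter> B = {}" by blast
qed

text \<open>A colouring that is consistent with a code determines the whole contour, hence the code.\<close>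

lemma codes_inj:
  assumes 1: "(I, O') \<in> codes B e d" and 2: "(J, P) \<in> codes B e d"
    and c1: "\<And>x. x \<in> (I - nbh B) \<union> O' \<Longrightarrow> \<xi> x = (x \<in> I)"
    and c2: "\<And>x. x \<in> (J - nbh B) \<union> P \<Longrightarrow> \<xi> x = (x \<in> J)"
  shows "I = J \<and> O' = P"
proof -
  \<comment> \<open>The colouring becomes a set that can be traced; on the sites visited by either
    contour it agrees with the set behind the code.\<close>
  define V where "V = nbh B \<union> {x. \<xi> x}"
  have det: "\<exists>m. I = inner_sites V e m \<and> O' = outer_sites V e m \<and> d \<le> card I \<and> (\<forall>k<m. card (inner_sites V e k) < d)"
    if code: "(I, O') \<in> codes B e d" and c: "\<And>x. x \<in> (I - nbh B) \<union> O' \<Longrightarrow> \<xi> x = (x \<in> I)" for I O'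
  proof -
    obtain U m where U: "nbh B \<subseteq> U" "e \<in> bdry U" "I = inner_sites U e m" "O' = outer_sites U e m"
      "d \<le> card I" "\<And>k. k < m \<Longrightarrow> card (inner_sites U e k) < d" "I \<subseteq> U" "O' \<inter> U = {}"
      using codesE[OF code] by metis
    have tr: "contour V e i = contour U e i" if "i \<le> m" for i
    proof (rule contour_cong[OF _ that])
      fix x assume "x \<in> inner_sites U e m \<union> outer_sites U e m"
      then show "x \<in> V \<longleftrightarrow> x \<in> U" using c[of x] U unfolding V_def by blast
    qed
    then have "inner_sites V e k = inner_sites U e k" "outer_sites V e k = outer_sites U e k" if "k \<le> m" for k
      using inner_outer_cong[of k V e U] that by auto
    then show ?thesis using U by (intro exI[of _ m]) auto
  qed
  obtain m where m: "I = inner_sites V e m" "O' = outer_sites V e m" "d \<le> card I" "\<forall>k<m. card (inner_sites V e k) < d"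
    using det[OF 1 c1] by blast
  obtain m' where m': "J = inner_sites V e m'" "P = outer_sites V e m'" "d \<le> card J" "\<forall>k<m'. card (inner_sites V e k) < d"
    using det[OF 2 c2] by blast
  have "m = m'" using m m' by (metis leD nat_neq_iff)
  then show ?thesis using m m' by simp
qed

text \<open>The configurations that admit such an \<open>A\<close> are covered by a measurable set,
  a countable union over codes, in place of a proof that they form an event themselves. The factor
  \<open>(1/2) ^ card B\<close> is the price of the pattern \<open>c\<close>.\<close>

lemma prob_thick:
  assumes "finite B"
  obtains S where "S \<in> sets perc" "perc.prob S \<le> (1/2) ^ card B * rho ^ d"
    "\<And>\<omega> A m. \<lbrakk>\<omega> \<in> space perc; \<And>x. x \<in> B \<Longrightarrow> \<omega> (pt x) = c x; thick B (\<lambda>v. \<omega> (pt v)) A; e \<in> bdry (nbh A);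
       d \<le> card (inner_sites (nbh A) e m)\<rbrakk> \<Longrightarrow> \<omega> \<in> S"
proof -
  define c' where "c' x \<longleftrightarrow> x \<in> B \<and> c x" for x
  define E where "E C = event (\<lambda>\<eta>. (\<forall>x\<in>B \<union> fst C \<union> snd C. \<eta> x = c' x) \<and>
     (\<forall>b\<in>fst C - nbh B. \<not> (\<forall>x\<in>{a. adj b a} - (fst C \<union> snd C). \<eta> x = c' x)))" for C
  define F where "F C = event (\<lambda>\<eta>. \<forall>x\<in>(fst C - nbh B) \<union> snd C. \<eta> x = (x \<in> fst C))" for C
  let ?C = "codes B e d"
  have "?C \<subseteq> {F. finite F} \<times> {F. finite F}"
    proof
    fix C assume "C \<in> ?C"
    then show "C \<in> {F. finite F} \<times> {F. finite F}"
      using codes_disjoint(1,2)[of "fst C" "snd C" B e d] by (simp add: mem_Times_iff)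
  qed
  moreover have "countable ({F :: (int \<times> int) set. finite F})" using countable_Collect_finite .
  ultimately have cnt: "countable ?C" using countable_SIGMA countable_subset by metis
  have EF: "E C \<in> sets perc" "F C \<in> sets perc" "perc.prob (E C) \<le> (1/2) ^ card B * rho ^ d * perc.prob (F C)"
    if "C \<in> ?C" for C
  proof -
    have "(fst C, snd C) \<in> ?C" using that by simp
    note dis = codes_disjoint[OF this]
    note args = assms dis(1,2,3,4,5)
    show "E C \<in> sets perc" unfolding E_def c'_def by (rule prob_code(1)[OF args])
    show "F C \<in> sets perc" unfolding F_def by (rule prob_code(2)[OF args])
    show "perc.prob (E C) \<le> (1/2) ^ card B * rho ^ d * perc.prob (F C)"
      unfolding E_def F_def c'_def by (rule prob_code(3)[OF args])
  qed
  have "disjoint_family_on F ?C"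
    unfolding disjoint_family_on_def
  proof (intro ballI impI equals0I)
    fix C D \<omega> assume C: "C \<in> ?C" "D \<in> ?C" "C \<noteq> D" "\<omega> \<in> F C \<inter> F D"
    then have "(fst C, snd C) \<in> ?C" "(fst D, snd D) \<in> ?C" by simp_all
    moreover have "\<omega> (pt x) = (x \<in> fst C)" if "x \<in> (fst C - nbh B) \<union> snd C" for x
      using C(4) that by (simp add: F_def event_def)
    moreover have "\<omega> (pt x) = (x \<in> fst D)" if "x \<in> (fst D - nbh B) \<union> snd D" for x
      using C(4) that by (simp add: F_def event_def)
    ultimately have "fst C = fst D \<and> snd C = snd D" by (rule codes_inj)
    then show False using C(3) prod_eq_iff by blast
  qed
  then have "perc.prob (\<Union>C\<in>?C. E C) \<le> (1/2) ^ card B * rho ^ d"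
    using rho by (intro perc.prob_UN_le[OF cnt, where F = F] EF) auto
  moreover have "(\<Union>C\<in>?C. E C) \<in> sets perc" using cnt EF by auto
  moreover have "\<omega> \<in> (\<Union>C\<in>?C. E C)"
    if \<omega>: "\<omega> \<in> space perc" "\<And>x. x \<in> B \<Longrightarrow> \<omega> (pt x) = c x" and th: "thick B (\<lambda>v. \<omega> (pt v)) A"
      and e: "e \<in> bdry (nbh A)" and m: "d \<le> card (inner_sites (nbh A) e m)" for \<omega> A m
  proof -
    let ?U = "nbh A"
    define k where "k = (LEAST m. d \<le> card (inner_sites ?U e m))"
    have k: "d \<le> card (inner_sites ?U e k)" unfolding k_def using m by (rule LeastI)
    have "card (inner_sites ?U e i) < d" if "i < k" for i
      using not_less_Least[of i "\<lambda>m. d \<le> card (inner_sites ?U e m)"] that unfolding k_def by auto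
    then have code: "(inner_sites ?U e k, outer_sites ?U e k) \<in> ?C"
      using th e k unfolding codes_def thick_def by blast
    note dis = codes_disjoint[OF code]
    have "\<omega> \<in> E (inner_sites ?U e k, outer_sites ?U e k)"
      unfolding E_def event_def fst_conv snd_conv mem_Collect_eq
    proof (intro conjI ballI \<omega>(1))
      fix x assume "x \<in> B \<union> inner_sites ?U e k \<union> outer_sites ?U e k"
      then consider "x \<in> B" | "x \<in> inner_sites ?U e k" | "x \<in> outer_sites ?U e k" by blast
      then show "\<omega> (pt x) = c' x"
      proof cases
        case 1 then show ?thesis using \<omega>(2) by (simp add: c'_def)
      next
        case 2
        then have "\<not> \<omega> (pt x)" using inner_sites_bdry[OF e] thick_bdry(1)[OF th] by meson
        moreover have "x \<notin> B" using dis(4) 2 by blast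
        ultimately show ?thesis by (simp add: c'_def)
      next
        case 3
        then have "\<not> \<omega> (pt x)" using outer_sites_bdry[OF e] thick_bdry(2)[OF th] by meson
        moreover have "x \<notin> B" using dis(4) 3 by blast
        ultimately show ?thesis by (simp add: c'_def)
      qed
    next
      fix b assume b: "b \<in> inner_sites ?U e k - nbh B"
      then obtain a where a: "adj b a" "\<omega> (pt a)"
        using inner_sites_bdry[OF e] thick_bdry(3)[OF th] by (metis DiffE)
      have "a \<notin> B" using b adj_sym_imp[OF a(1)] by (auto simp: nbh_def)
      moreover have "a \<notin> inner_sites ?U e k" "a \<notin> outer_sites ?U e k"
        using a(2) inner_sites_bdry[OF e] outer_sites_bdry[OF e] thick_bdry(1,2)[OF th] by meson+
      ultimately show "\<not> (\<forall>x\<in>{a. adj b a} - (inner_sites ?U e k \<union> outer_sites ?U e k). \<omega> (pt x) = c' x)"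
        using a unfolding c'_def by blast
    qed
    then show ?thesis using code by blast
  qed
  ultimately show ?thesis using that by blast
qed

section \<open>Finiteness of contours and uniqueness\<close>

definition opens :: "(complex \<Rightarrow> bool) \<Rightarrow> (int \<times> int) set" where
  "opens \<omega> = {v. \<omega> (pt v)}"

lemma translate_nbh: "nbh ((+) t ` A) = (+) t ` nbh A"
proof -
  have adj: "adj (t + u) (t + v) = adj u v" for u v by (simp add: adj_def)
  show ?thesis
  proof (intro equalityI subsetI)
    fix x assume "x \<in> nbh ((+) t ` A)"
    then obtain u where u: "u \<in> A" "x = t + u \<or> adj (t + u) x" by (auto simp: nbh_def)
    then have "x - t = u \<or> adj u (x - t)" using adj[of u "x - t"] by auto
    then have "x - t \<in> nbh A" using u(1) by (auto simp: nbh_def)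
    then show "x \<in> (+) t ` nbh A" by (metis add.commute diff_add_cancel imageI)
  next
    fix x assume "x \<in> (+) t ` nbh A"
    then show "x \<in> nbh ((+) t ` A)" using adj by (fastforce simp: nbh_def)
  qed
qed

lemma thick_linked:
  assumes "u \<in> opens \<omega>" shows "thick {} (\<lambda>v. \<omega> (pt v)) (linked (opens \<omega>) u)"
proof -
  have "x \<in> linked (opens \<omega>) u" if x: "x \<in> nbh (nbh (linked (opens \<omega>) u))" "\<omega> (pt x)" for x
  proof -
    obtain a where "a \<in> linked (opens \<omega>) u" "link a x" using x(1) unfolding nbh_nbh by blast
    then show ?thesis using linked_link assms x(2) by (auto simp: opens_def)
  qed
  moreover have "\<omega> (pt a)" if "a \<in> linked (opens \<omega>) u" for a
    using linked_subset[OF assms] that by (auto simp: opens_def)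
  ultimately show ?thesis by (auto simp: thick_def nbh_def[of "{}"])
qed

text \<open>An infinite contour meets at least \<open>d\<close> inner sites for every
  \<open>d\<close>, which puts the configuration into sets of probability at most
  \<open>rho ^ d\<close>. There are countably many starting edges.\<close>

lemma AE_finite_contours:
  "AE \<omega> in perc. \<forall>e u. u \<in> opens \<omega> \<longrightarrow> e \<in> bdry (nbh (linked (opens \<omega>) u)) \<longrightarrow>
     finite (range (contour (nbh (linked (opens \<omega>) u)) e))"
proof (subst AE_all_countable, rule allI)
  fix e
  define Q where "Q d S \<longleftrightarrow> S \<in> sets perc \<and> perc.prob S \<le> rho ^ d \<and>
    (\<forall>\<omega> A m. \<omega> \<in> space perc \<longrightarrow> thick {} (\<lambda>v. \<omega> (pt v)) A \<longrightarrow> e \<in> bdry (nbh A) \<longrightarrow>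
       d \<le> card (inner_sites (nbh A) e m) \<longrightarrow> \<omega> \<in> S)" for d S
  have "\<exists>S. Q d S" for d
    using prob_thick[of "{}" d "\<lambda>_. False" e] unfolding Q_def by (metis card.empty empty_iff finite.emptyI mult_1 power_0)
  then obtain S where S: "\<And>d. Q d (S d)" by metis
  define N where "N = (\<Inter>d. S d)"
  have N: "N \<in> sets perc" unfolding N_def using S by (intro sets.countable_INT) (auto simp: Q_def)
  have "perc.prob N \<le> rho ^ d" for d
  proof -
    have "perc.prob N \<le> perc.prob (S d)"
      using S[of d] by (intro perc.finite_measure_mono) (auto simp: N_def Q_def)
    then show ?thesis using S[of d] by (simp add: Q_def)
  qed
  moreover have "(\<lambda>d. rho ^ d) \<longlonglongrightarrow> 0" using rho by (intro LIMSEQ_realpow_zero) auto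
  ultimately have "perc.prob N \<le> 0" by (intro LIMSEQ_le_const) auto
  then have "N \<in> null_sets perc"
    using N by (simp add: null_sets_def perc.emeasure_eq_measure measure_le_0_iff)
  then show "AE \<omega> in perc. \<forall>u. u \<in> opens \<omega> \<longrightarrow> e \<in> bdry (nbh (linked (opens \<omega>) u)) \<longrightarrow>
     finite (range (contour (nbh (linked (opens \<omega>) u)) e))"
  proof (rule AE_I')
    show "{\<omega> \<in> space perc. \<not> (\<forall>u. u \<in> opens \<omega> \<longrightarrow> e \<in> bdry (nbh (linked (opens \<omega>) u)) \<longrightarrow>
      finite (range (contour (nbh (linked (opens \<omega>) u)) e)))} \<subseteq> N"
    proof
      fix \<omega> assume "\<omega> \<in> {\<omega> \<in> space perc. \<not> (\<forall>u. u \<in> opens \<omega> \<longrightarrow> e \<in> bdry (nbh (linked (opens \<omega>) u)) \<longrightarrow>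
        finite (range (contour (nbh (linked (opens \<omega>) u)) e)))}"
      then obtain u where u: "\<omega> \<in> space perc" "u \<in> opens \<omega>" "e \<in> bdry (nbh (linked (opens \<omega>) u))"
        "infinite (range (contour (nbh (linked (opens \<omega>) u)) e))" by auto
      have "\<omega> \<in> S d" for d
      proof -
        obtain m where "d \<le> card (inner_sites (nbh (linked (opens \<omega>) u)) e m)"
          using finite_orbit[OF u(3), of d] u(4) by (meson not_less)
        then show ?thesis using S[of d] u(1,3) thick_linked[OF u(2)] unfolding Q_def by blast
      qed
      then show "\<omega> \<in> N" by (simp add: N_def)
    qed
  qed
qed

text \<open>Sites of different components have no common neighbour, so the closed neighbourhoods of
  the components are disjoint and \<open>no_two_infinite\<close> applies.\<close>

lemma AE_infinite_linked_unique:
  "AE \<omega> in perc. \<forall>u\<in>opens \<omega>. \<forall>v\<in>opens \<omega>. infinite (linked (opens \<omega>) u) \<longrightarrow> infinite (linked (opens \<omega>) v) \<longrightarrow>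
     v \<in> linked (opens \<omega>) u"
  using AE_finite_contours
proof (rule AE_mp, intro AE_I2 impI ballI)
  fix \<omega> u v
  assume fin: "\<forall>e u. u \<in> opens \<omega> \<longrightarrow> e \<in> bdry (nbh (linked (opens \<omega>) u)) \<longrightarrow>
     finite (range (contour (nbh (linked (opens \<omega>) u)) e))"
    and u: "u \<in> opens \<omega>" "infinite (linked (opens \<omega>) u)" and v: "v \<in> opens \<omega>" "infinite (linked (opens \<omega>) v)"
  let ?A = "linked (opens \<omega>) u" and ?B = "linked (opens \<omega>) v"
  show "v \<in> ?A"
  proof (rule ccontr)
    assume nv: "v \<notin> ?A"
    have "nbh ?A \<inter> nbh ?B = {}"
    proof (rule ccontr)
      assume "nbh ?A \<inter> nbh ?B \<noteq> {}"
      then obtain x a b where x: "a \<in> ?A" "x = a \<or> adj a x" "b \<in> ?B" "x = b \<or> adj b x"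
        unfolding nbh_def by blast
      then have "a \<in> nbh {x}" "b \<in> nbh {x}" using nbh_single nbh_single_sym by blast+
      then have "link a b" unfolding link_def by blast
      moreover have "b \<in> opens \<omega>" using x(3) linked_subset[OF v(1)] by blast
      ultimately have "b \<in> ?A" using linked_link[OF x(1) u(1)] by blast
      then have "v \<in> ?A" using linked_trans[of b] x(3) linked_sym by blast
      then show False using nv by blast
    qed
    then show False
      using no_two_infinite[OF u(2) self_linked _ v(2) self_linked] linked_connected fin u(1) by blast
  qed
qed

text \<open>The end \<open>j\<close> of the row inside the contour is unknown, but a contour
  starting there has at least \<open>j\<close> inner sites. The geometric series over
  \<open>j \<ge> n\<close> is still of order \<open>rho ^ n\<close>.\<close>

lemma prob_thick_finite:
  assumes "finite B"
  obtains S where "S \<in> sets perc" "perc.prob S \<le> (1/2) ^ card B * (rho ^ n / (1 - rho))"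
    "\<And>\<omega> A. \<lbrakk>\<omega> \<in> space perc; \<And>x. x \<in> B \<Longrightarrow> \<omega> (pt x) = c x; thick B (\<lambda>v. \<omega> (pt v)) A; finite A;
       (x, y) \<in> A; \<And>a. a \<in> A \<Longrightarrow> ((x, y), a) \<in> (links A)\<^sup>*; (x + int n, y) \<in> A\<rbrakk> \<Longrightarrow> \<omega> \<in> S"
proof -
  define e where "e j = ((x + int j, y), (x + int j + 1, y))" for j
  define Q where "Q j S \<longleftrightarrow> S \<in> sets perc \<and> perc.prob S \<le> (1/2) ^ card B * rho ^ j \<and>
    (\<forall>\<omega> A m. \<omega> \<in> space perc \<longrightarrow> (\<forall>x\<in>B. \<omega> (pt x) = c x) \<longrightarrow> thick B (\<lambda>v. \<omega> (pt v)) A \<longrightarrow> e j \<in> bdry (nbh A) \<longrightarrow>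
       j \<le> card (inner_sites (nbh A) (e j) m) \<longrightarrow> \<omega> \<in> S)" for j S
  have "\<exists>S. Q j S" for j
  proof -
    obtain S where "S \<in> sets perc" "perc.prob S \<le> (1/2) ^ card B * rho ^ j"
      "\<And>\<omega> A m. \<lbrakk>\<omega> \<in> space perc; \<And>x. x \<in> B \<Longrightarrow> \<omega> (pt x) = c x; thick B (\<lambda>v. \<omega> (pt v)) A; e j \<in> bdry (nbh A);
       j \<le> card (inner_sites (nbh A) (e j) m)\<rbrakk> \<Longrightarrow> \<omega> \<in> S"
      using prob_thick[OF assms] by metis
    then show ?thesis unfolding Q_def by blast
  qed
  then obtain S where S: "\<And>j. Q j (S j)" by metis
  define T where "T = (\<Union>j. S (n + j))"
  have T: "T \<in> sets perc" unfolding T_def using S by (auto simp: Q_def)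
  have sums: "(\<lambda>j. (1/2) ^ card B * rho ^ (n + j)) sums ((1/2) ^ card B * (rho ^ n / (1 - rho)))"
  proof -
    have "(\<lambda>j. rho ^ j) sums (1 / (1 - rho))" using rho by (intro geometric_sums) simp
    then have "(\<lambda>j. ((1/2) ^ card B * rho ^ n) * rho ^ j) sums (((1/2) ^ card B * rho ^ n) * (1 / (1 - rho)))"
      by (rule sums_mult)
    then show ?thesis by (simp add: power_add mult.assoc)
  qed
  have le: "perc.prob (S (n + j)) \<le> (1/2) ^ card B * rho ^ (n + j)" for j using S by (simp add: Q_def)
  have "summable (\<lambda>j. perc.prob (S (n + j)))"
    using le by (intro summable_comparison_test'[OF sums_summable[OF sums], of 0]) simp
  then have "perc.prob T \<le> (\<Sum>j. perc.prob (S (n + j)))"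
    unfolding T_def using S by (intro perc.finite_measure_subadditive_countably) (auto simp: Q_def)
  also have "\<dots> \<le> (\<Sum>j. (1/2) ^ card B * rho ^ (n + j))"
    by (rule suminf_le[OF le \<open>summable (\<lambda>j. perc.prob (S (n + j)))\<close> sums_summable[OF sums]])
  also have "\<dots> = (1/2) ^ card B * (rho ^ n / (1 - rho))" by (rule sums_unique[OF sums, symmetric])
  finally have P: "perc.prob T \<le> (1/2) ^ card B * (rho ^ n / (1 - rho))" .
  have "\<omega> \<in> T" if \<omega>: "\<omega> \<in> space perc" "\<And>x. x \<in> B \<Longrightarrow> \<omega> (pt x) = c x" "thick B (\<lambda>v. \<omega> (pt v)) A"
    and A: "finite A" "(x, y) \<in> A" "\<And>a. a \<in> A \<Longrightarrow> ((x, y), a) \<in> (links A)\<^sup>*" "(x + int n, y) \<in> A" for \<omega> A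
  proof -
    obtain j m where j: "n < j" "e j \<in> bdry (nbh A)" "j \<le> card (inner_sites (nbh A) (e j) m)"
      using enclosing_contour[OF A] unfolding e_def by metis
    then have "\<omega> \<in> S j" using S[of j] \<omega> unfolding Q_def by blast
    moreover have "j = n + (j - n)" using j by simp
    ultimately show ?thesis unfolding T_def by (metis UN_I UNIV_I)
  qed
  then show ?thesis by (rule that[OF T P])
qed

section \<open>An infinite component near a long segment\<close>

definition segment :: "int \<times> int \<Rightarrow> nat \<Rightarrow> (int \<times> int) set" where
  "segment v n = (\<lambda>i. (fst v + int i, snd v)) ` {..n}"

lemma finite_segment [simp]: "finite (segment v n)"
  by (simp add: segment_def)

lemma adj_segment: "adj (x + int i, y) (x + int (Suc i), y)"
  by (simp add: adj_pair)

text \<open>The segment is added to the open sites whatever its actual states are. If all components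
  near it are finite, so is the merged one, which then has a long enclosing contour. The sum over
  the \<open>2 ^ card ?B\<close> patterns on the segment cancels the factor
  \<open>(1/2) ^ card ?B\<close>.\<close>

lemma infinite_near_segment:
  obtains S where "S \<in> sets perc" "perc.prob S \<le> rho ^ n / (1 - rho)"
    "\<And>\<omega>. \<lbrakk>\<omega> \<in> space perc; \<omega> \<notin> S\<rbrakk> \<Longrightarrow>
       \<exists>x\<in>nbh (nbh (segment (0,0) n)). x \<in> opens \<omega> \<and> infinite (linked (opens \<omega>) x)"
proof -
  let ?B = "segment (0,0) n"
  have "\<exists>S. S \<in> sets perc \<and> perc.prob S \<le> (1/2) ^ card ?B * (rho ^ n / (1 - rho)) \<and>
    (\<forall>\<omega> A. \<omega> \<in> space perc \<longrightarrow> (\<forall>x\<in>?B. \<omega> (pt x) = (x \<in> C)) \<longrightarrow> thick ?B (\<lambda>v. \<omega> (pt v)) A \<longrightarrow> finite A \<longrightarrow>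
       (0, 0) \<in> A \<longrightarrow> (\<forall>a\<in>A. ((0, 0), a) \<in> (links A)\<^sup>*) \<longrightarrow> (int n, 0) \<in> A \<longrightarrow> \<omega> \<in> S)" for C
    by (rule prob_thick_finite[OF finite_segment[of "(0,0)" n], where n = n and c = "\<lambda>x. x \<in> C" and x = 0 and y = 0])
      (metis add_0)
  then obtain S where S: "\<And>C. S C \<in> sets perc" "\<And>C. perc.prob (S C) \<le> (1/2) ^ card ?B * (rho ^ n / (1 - rho))"
    "\<And>C \<omega> A. \<lbrakk>\<omega> \<in> space perc; \<forall>x\<in>?B. \<omega> (pt x) = (x \<in> C); thick ?B (\<lambda>v. \<omega> (pt v)) A; finite A;
       (0, 0) \<in> A; \<forall>a\<in>A. ((0, 0), a) \<in> (links A)\<^sup>*; (int n, 0) \<in> A\<rbrakk> \<Longrightarrow> \<omega> \<in> S C"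
    by metis
  define T where "T = (\<Union>C\<in>Pow ?B. S C)"
  have T: "T \<in> sets perc" unfolding T_def using S(1) by auto
  have "perc.prob T \<le> (\<Sum>C\<in>Pow ?B. perc.prob (S C))"
    unfolding T_def using S(1) by (intro perc.finite_measure_subadditive_finite) auto
  also have "\<dots> \<le> (\<Sum>C\<in>Pow ?B. (1/2) ^ card ?B * (rho ^ n / (1 - rho)))"
    by (rule sum_mono) (rule S)
  also have "\<dots> = rho ^ n / (1 - rho)"
    by (simp add: card_Pow power_mult_distrib[symmetric] mult.assoc[symmetric] power_one_over)
  finally have P: "perc.prob T \<le> rho ^ n / (1 - rho)" .
  have "\<exists>x\<in>nbh (nbh ?B). x \<in> opens \<omega> \<and> infinite (linked (opens \<omega>) x)" if \<omega>: "\<omega> \<in> space perc" "\<omega> \<notin> T" for \<omega>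
  proof (rule ccontr)
    assume "\<not> ?thesis"
    then have no: "finite (linked (opens \<omega>) x)" if "x \<in> nbh (nbh ?B)" "x \<in> opens \<omega>" for x using that by blast
    let ?V = "?B \<union> opens \<omega>"
    define A where "A = linked ?V (0,0)"
    have 0: "(0,0) \<in> ?V" by (force simp: segment_def)
    have seg: "(0 + int i, 0) \<in> A" if "i \<le> n" for i
      using that
    proof (induction i)
      case 0 then show ?case using self_linked by (simp add: A_def)
    next
      case (Suc i)
      have "(0 + int (Suc i), 0) \<in> ?V" using Suc.prems by (force simp: segment_def)
      then show ?case using Suc linked_link[OF _ 0] adj_link[OF adj_segment[of 0 i 0]] unfolding A_def by simp
    qed
    have "?B \<subseteq> A" using seg by (auto simp: segment_def)
    have thick: "thick ?B (\<lambda>v. \<omega> (pt v)) A"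
      unfolding thick_def
    proof (intro conjI ballI impI)
      show "nbh ?B \<subseteq> nbh A" using \<open>?B \<subseteq> A\<close> by (rule nbh_mono)
      show "\<not> \<omega> (pt x)" if x: "x \<in> nbh (nbh A)" "x \<notin> A" for x
      proof
        assume "\<omega> (pt x)"
        obtain a where "a \<in> A" "link a x" using x(1) unfolding nbh_nbh by blast
        then show False using linked_link[OF _ 0] x(2) \<open>\<omega> (pt x)\<close> unfolding A_def by (auto simp: opens_def)
      qed
      show "\<omega> (pt a)" if "a \<in> A" "a \<notin> ?B" for a
        using linked_subset[OF 0] that unfolding A_def by (auto simp: opens_def)
    qed
    \<comment> \<open>A link path leaves the segment through an open site within two steps of it,
      and then stays in the component of that site until it returns.\<close>
    have "a \<in> ?B \<union> (\<Union>x\<in>nbh (nbh ?B) \<inter> opens \<omega>. linked (opens \<omega>) x)" if "a \<in> A" for a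
      using that unfolding A_def linked_def[of ?V] mem_Collect_eq
    proof (induction rule: rtrancl_induct)
      case base then show ?case by (force simp: segment_def)
    next
      case (step a b)
      have ab: "a \<in> ?V" "b \<in> ?V" "link a b" using step(2) by (auto simp: links_def)
      consider "b \<in> ?B" | "b \<in> opens \<omega>" "a \<in> ?B"
        | x where "b \<in> opens \<omega>" "x \<in> nbh (nbh ?B)" "x \<in> opens \<omega>" "a \<in> linked (opens \<omega>) x"
        using ab step.IH by blast
      then show ?case
      proof cases
        case 2
        then have "b \<in> nbh (nbh ?B)" using ab(3) unfolding nbh_nbh by blast
        then show ?thesis using 2 self_linked by blast
      next
        case 3
        then have "b \<in> linked (opens \<omega>) x" using linked_link ab(3) by blast
        then show ?thesis using 3 by blast
      qed blast
    qed
    then have "A \<subseteq> ?B \<union> (\<Union>x\<in>nbh (nbh ?B) \<inter> opens \<omega>. linked (opens \<omega>) x)" by blast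
    moreover have "finite (?B \<union> (\<Union>x\<in>nbh (nbh ?B) \<inter> opens \<omega>. linked (opens \<omega>) x))"
      using no finite_nbh[OF finite_nbh[OF finite_segment]] by auto
    ultimately have "finite A" by (rule finite_subset)
    moreover have "\<forall>x\<in>?B. \<omega> (pt x) = (x \<in> ?B \<inter> opens \<omega>)" by (auto simp: opens_def)
    moreover have "\<forall>a\<in>A. ((0, 0), a) \<in> (links A)\<^sup>*" using linked_connected unfolding A_def by blast
    moreover have "(0,0) \<in> A" "(int n, 0) \<in> A" using seg[of 0] seg[of n] by simp_all
    ultimately have "\<omega> \<in> S (?B \<inter> opens \<omega>)"
      by (intro S(3)[OF \<omega>(1) _ thick])
    moreover have "?B \<inter> opens \<omega> \<in> Pow ?B" by simp
    ultimately show False using \<omega>(2) unfolding T_def by (meson UN_I)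
  qed
  then show ?thesis by (rule that[OF T P])
qed

section \<open>Isolated open sites in infinite components\<close>

definition lollipop :: "int \<times> int \<Rightarrow> nat \<Rightarrow> (int \<times> int) set" where
  "lollipop v n = nbh (nbh {v}) \<union> segment v n"

lemma finite_lollipop [simp]: "finite (lollipop v n)"
  by (simp add: lollipop_def finite_nbh)

lemma card_lollipop: "card (lollipop v n) = card (lollipop (0,0) n)"
proof -
  have "nbh (nbh {v}) = (+) v ` nbh (nbh {(0,0)})"
    using translate_nbh[of v "{(0,0)}"] translate_nbh[of v "nbh {(0,0)}"] by (simp flip: zero_prod_def)
  moreover have "segment v n = (+) v ` segment (0,0) n"
    by (auto simp: segment_def image_image prod_eq_iff)
  ultimately have "lollipop v n = (+) v ` lollipop (0,0) n" by (simp add: lollipop_def image_Un)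
  then show ?thesis by (simp add: card_image)
qed

lemma nbh_nbh_single: "x \<in> nbh (nbh {v}) \<longleftrightarrow> link v x"
  by (simp add: nbh_nbh)

text \<open>In the pattern below, \<open>v\<close> is an isolated open site surrounded by an open ring, to which an
  open segment is attached.\<close>

lemma lollipop_thick:
  assumes p: "\<And>x. x \<in> lollipop v n \<Longrightarrow> \<omega> (pt x) = (\<not> adj v x)" and n: "2 \<le> n"
  shows "v \<in> opens \<omega>" "thick (lollipop v n) (\<lambda>v. \<omega> (pt v)) (linked (opens \<omega>) v)"
    "(fst v + int n, snd v) \<in> linked (opens \<omega>) v"
proof -
  let ?A = "linked (opens \<omega>) v"
  have vv: "v \<in> lollipop v n" using subset_nbh by (auto simp: lollipop_def)
  show v: "v \<in> opens \<omega>" using p[OF vv] by (simp add: opens_def)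
  have ball: "x \<in> ?A" if "link v x" "\<not> adj v x" for x
  proof -
    have "x \<in> opens \<omega>" using p[of x] that by (simp add: lollipop_def nbh_nbh_single opens_def)
    then show ?thesis using linked_link[OF self_linked v] that by blast
  qed
  have seg: "(fst v + int (i + 2), snd v) \<in> ?A" if "i + 2 \<le> n" for i
    using that
  proof (induction i)
    case 0
    \<comment> \<open>The second site of the segment is closed; it serves as the common neighbour
      that links \<open>v\<close> to the third one, on the ring.\<close>
    have "link v (fst v + int (0 + 2), snd v)"
      unfolding link_def
      by (rule exI[of _ "(fst v + 1, snd v)"]) (cases v; simp add: nbh_single adj_pair)
    then show ?case by (intro ball) (cases v; simp_all add: adj_pair)+
  next
    case (Suc i)
    let ?x = "(fst v + int (Suc i + 2), snd v)"
    have "?x \<in> lollipop v n" using Suc.prems unfolding lollipop_def segment_def by blast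
    moreover have "\<not> adj v ?x" by (cases v) (simp add: adj_pair)
    ultimately have "?x \<in> opens \<omega>" using p by (simp add: opens_def)
    then show ?case using Suc linked_link[OF _ v] adj_link[OF adj_segment[of "fst v" "i + 2" "snd v"]] by simp
  qed
  show "(fst v + int n, snd v) \<in> ?A" using seg[of "n - 2"] n by simp
  have opn: "x \<in> ?A" if x: "x \<in> lollipop v n" "\<not> adj v x" for x
  proof (cases "x \<in> nbh (nbh {v})")
    case True then show ?thesis using ball x by (simp add: nbh_nbh_single)
  next
    case False
    then obtain i where i: "i \<le> n" "x = (fst v + int i, snd v)" using x by (auto simp: lollipop_def segment_def)
    then show ?thesis
    proof (cases "i \<ge> 2")
      case True then show ?thesis using seg[of "i - 2"] i by simp
    next
      case False
      then consider "i = 0" | "i = 1" by linarith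
      then show ?thesis
      proof cases
        case 1 then show ?thesis using i self_linked by simp
      next
        case 2
        then have "adj v x" using i by (cases v) (simp add: adj_pair)
        then show ?thesis using x by blast
      qed
    qed
  qed
  have "nbh (lollipop v n) \<subseteq> nbh ?A"
  proof
    fix x assume "x \<in> nbh (lollipop v n)"
    then obtain b where b: "b \<in> lollipop v n" "x = b \<or> adj b x" unfolding nbh_def by blast
    show "x \<in> nbh ?A"
    proof (cases "adj v b")
      case False then show ?thesis using opn b unfolding nbh_def by blast
    next
      \<comment> \<open>A closed site \<open>b\<close> of the pattern is not in the component, but
        its neighbours are within two steps of \<open>v\<close>: each is next to \<open>v\<close> or
        belongs to the component itself.\<close>
      case True
      then have "x \<in> nbh {b}" "v \<in> nbh {b}" using b adj_sym by (auto simp: nbh_single)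
      then have "link v x" unfolding link_def by blast
      then show ?thesis
        using ball[of x] self_linked[of v "opens \<omega>"] subset_nbh[of ?A] unfolding nbh_def[of ?A] by blast
    qed
  qed
  then show "thick (lollipop v n) (\<lambda>v. \<omega> (pt v)) ?A"
    using thick_linked[OF v] unfolding thick_def by blast
qed

text \<open>Compared with the probability \<open>(1/2) ^ card (lollipop v n)\<close> of the pattern,
  the exceptional set is small for large \<open>n\<close>. An isolated site is a cluster by itself,
  so that many such sites yield many clusters. The colouring \<open>c\<close> is a parameter because
  one function has to serve many disjoint lollipops.\<close>

lemma prob_lollipop_finite:
  assumes n: "2 \<le> n" and c: "\<And>x. x \<in> lollipop v n \<Longrightarrow> c x = (\<not> adj v x)"
  obtains S where "S \<in> sets perc" "perc.prob S \<le> (1/2) ^ card (lollipop v n) * (rho ^ n / (1 - rho))"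
    "\<And>\<omega>. \<lbrakk>\<omega> \<in> space perc; \<And>x. x \<in> lollipop v n \<Longrightarrow> \<omega> (pt x) = c x; \<omega> \<notin> S\<rbrakk> \<Longrightarrow>
       v \<in> opens \<omega> \<and> (\<forall>u. adj v u \<longrightarrow> u \<notin> opens \<omega>) \<and> infinite (linked (opens \<omega>) v)"
proof -
  obtain x y where v: "v = (x, y)" by fastforce
  obtain S where S: "S \<in> sets perc" "perc.prob S \<le> (1/2) ^ card (lollipop v n) * (rho ^ n / (1 - rho))"
    "\<And>\<omega> A. \<lbrakk>\<omega> \<in> space perc; \<And>x. x \<in> lollipop v n \<Longrightarrow> \<omega> (pt x) = c x; thick (lollipop v n) (\<lambda>v. \<omega> (pt v)) A; finite A;
       (x, y) \<in> A; \<And>a. a \<in> A \<Longrightarrow> ((x, y), a) \<in> (links A)\<^sup>*; (x + int n, y) \<in> A\<rbrakk> \<Longrightarrow> \<omega> \<in> S"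
    using prob_thick_finite[OF finite_lollipop, of v n n c x y] by blast
  show ?thesis
  proof (rule that[OF S(1,2)])
    fix \<omega> assume \<omega>: "\<omega> \<in> space perc" "\<And>x. x \<in> lollipop v n \<Longrightarrow> \<omega> (pt x) = c x" "\<omega> \<notin> S"
    then have p: "\<omega> (pt x) = (\<not> adj v x)" if "x \<in> lollipop v n" for x using c that by simp
    note L = lollipop_thick[of v n \<omega>, OF p n]
    have "u \<notin> opens \<omega>" if "adj v u" for u
      using p[of u] that by (auto simp: opens_def lollipop_def nbh_nbh_single adj_link)
    moreover have "infinite (linked (opens \<omega>) v)"
    proof
      assume "finite (linked (opens \<omega>) v)"
      then have "\<omega> \<in> S"
        using S(3)[OF \<omega>(1,2) L(2)] self_linked[of v] linked_connected L(3) v by simp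
      then show False using \<omega> by blast
    qed
    ultimately show "v \<in> opens \<omega> \<and> (\<forall>u. adj v u \<longrightarrow> u \<notin> opens \<omega>) \<and> infinite (linked (opens \<omega>) v)"
      using L(1) by blast
  qed
qed

text \<open>For large \<open>n\<close> the exceptional set is less likely than the pattern, so
  something of positive probability remains. This serves the tail at small \<open>k\<close>, where a
  bound by \<open>rho ^ n / (1 - rho)\<close> says nothing.\<close>

lemma prob_origin_infinite_pos:
  obtains S where "S \<in> sets perc" "perc.prob S > 0"
    "\<And>\<omega>. \<omega> \<in> S \<Longrightarrow> (0,0) \<in> opens \<omega> \<and> infinite (linked (opens \<omega>) (0,0))"
proof -
  have "(\<lambda>n. rho ^ n / (1 - rho)) \<longlonglongrightarrow> 0 / (1 - rho)"
    using rho by (intro tendsto_divide LIMSEQ_realpow_zero tendsto_const) auto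
  then have "(\<lambda>n. rho ^ n / (1 - rho)) \<longlonglongrightarrow> 0" by simp
  then have "\<forall>\<^sub>F n in sequentially. rho ^ n / (1 - rho) < 1"
    by (rule order_tendstoD) simp
  then have "\<forall>\<^sub>F n in sequentially. rho ^ n / (1 - rho) < 1 \<and> 2 \<le> n"
    using eventually_ge_at_top by (rule eventually_conj)
  then have "\<exists>n. rho ^ n / (1 - rho) < 1 \<and> 2 \<le> n" using eventually_happens by force
  then obtain n where n: "rho ^ n / (1 - rho) < 1" "2 \<le> n" by blast
  let ?B = "lollipop (0,0) n" and ?c = "\<lambda>x. \<not> adj (0,0) x"
  let ?good = "\<lambda>\<omega>. (0,0) \<in> opens \<omega> \<and> (\<forall>u. adj (0,0) u \<longrightarrow> u \<notin> opens \<omega>) \<and> infinite (linked (opens \<omega>) (0,0))"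
  show ?thesis
  proof (rule prob_lollipop_finite[OF n(2), of "(0,0)" ?c])
    fix S assume S: "S \<in> sets perc" "perc.prob S \<le> (1/2) ^ card ?B * (rho ^ n / (1 - rho))"
      "\<And>\<omega>. \<lbrakk>\<omega> \<in> space perc; \<And>x. x \<in> ?B \<Longrightarrow> \<omega> (pt x) = ?c x; \<omega> \<notin> S\<rbrakk> \<Longrightarrow>
         ?good \<omega>"
    let ?E = "event (\<lambda>\<eta>. \<forall>x\<in>?B. \<eta> x = ?c x)"
    have E: "?E \<in> sets perc" "perc.prob ?E = (1/2) ^ card ?B" by (intro prob_pattern; simp)+
    show thesis
    proof (rule that[of "?E - S"])
      show "?E - S \<in> sets perc" using E S by auto
      have "perc.prob ?E - perc.prob S \<le> perc.prob (?E - S)"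
        using E S measure_Un_le[of "?E - S" perc S] perc.finite_measure_mono[of ?E "?E - S \<union> S"] by auto
      moreover have "perc.prob S < perc.prob ?E"
        using S(2) n(1) mult_strict_left_mono[OF n(1), of "(1/2) ^ card ?B"] E(2) by simp
      ultimately show "perc.prob (?E - S) > 0" by simp
      show "(0,0) \<in> opens \<omega> \<and> infinite (linked (opens \<omega>) (0,0))" if "\<omega> \<in> ?E - S" for \<omega>
        using S(3)[of \<omega>] that by (simp add: event_def)
    qed
  qed simp
qed

lemma lollipop_height: "u \<in> lollipop v n \<Longrightarrow> \<bar>snd u - snd v\<bar> \<le> 2"
proof -
  have adj: "\<bar>snd a - snd b\<bar> \<le> 1" if "adj a b" for a b
    using that by (cases a; cases b) (auto simp: adj_pair)
  have nb: "\<bar>snd a - snd b\<bar> \<le> 1" if "a \<in> nbh {b}" for a b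
    using that adj[of b a] by (auto simp: nbh_single)
  assume "u \<in> lollipop v n"
  then consider "link v u" | "u \<in> segment v n" by (auto simp: lollipop_def nbh_nbh_single)
  then show ?thesis
  proof cases
    case 1
    then obtain z where "v \<in> nbh {z}" "u \<in> nbh {z}" by (auto simp: link_def)
    then show ?thesis using nb[of v z] nb[of u z] by linarith
  qed (auto simp: segment_def)
qed

text \<open>Among \<open>n * 2 ^ s\<close> disjoint places, each showing the pattern with
  probability \<open>(1/2) ^ s\<close>, all fail with probability at most
  \<open>exp (- real n)\<close>, while the exceptional sets add up to
  \<open>real n * rho ^ n / (1 - rho)\<close>. Both tend to 0, and independence is asked of the
  patterns alone, not of the infinite components.\<close>

lemma AE_isolated_far:
  "AE \<omega> in perc. \<forall>R::nat. \<exists>i\<ge>R. (0, 5 * int i) \<in> opens \<omega> \<and> (\<forall>u. adj (0, 5 * int i) u \<longrightarrow> u \<notin> opens \<omega>) \<and>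
     infinite (linked (opens \<omega>) (0, 5 * int i))"
  unfolding AE_all_countable
proof
  fix R :: nat
  \<comment> \<open>A lollipop stays within height 2 of its row, so rows at distance 5 keep the
    lollipops disjoint.\<close>
  define v where "v i = (0 :: int, 5 * int i)" for i
  \<comment> \<open>One colouring for all places, as \<open>prob_pattern_avoid\<close> requires;
    inside one lollipop only its own centre has an effect.\<close>
  define c where "c x \<longleftrightarrow> \<not> (\<exists>i. adj (v i) x)" for x
  define good where "good \<omega> i \<longleftrightarrow> v i \<in> opens \<omega> \<and> (\<forall>u. adj (v i) u \<longrightarrow> u \<notin> opens \<omega>) \<and>
     infinite (linked (opens \<omega>) (v i))" for \<omega> i
  have c: "c x = (\<not> adj (v i) x)" if "x \<in> lollipop (v i) n" for x i n
  proof -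
    have "j = i" if "adj (v j) x" for j
    proof -
      have "x \<in> lollipop (v j) n" using that by (simp add: lollipop_def nbh_nbh_single adj_link)
      then have "\<bar>snd x - 5 * int j\<bar> \<le> 2" "\<bar>snd x - 5 * int i\<bar> \<le> 2"
        using lollipop_height \<open>x \<in> lollipop (v i) n\<close> by (fastforce simp: v_def)+
      then show ?thesis by linarith
    qed
    then show ?thesis unfolding c_def by blast
  qed
  have disj: "lollipop (v i) n \<inter> lollipop (v j) n = {}" if "i \<noteq> j" for i j n
  proof (rule ccontr)
    assume "\<not> ?thesis"
    then obtain x where "x \<in> lollipop (v i) n" "x \<in> lollipop (v j) n" by blast
    then have "\<bar>snd x - 5 * int j\<bar> \<le> 2" "\<bar>snd x - 5 * int i\<bar> \<le> 2"
      using lollipop_height by (fastforce simp: v_def)+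
    then show False using that by linarith
  qed
  have ex: "\<exists>T. T \<in> sets perc \<and> perc.prob T \<le> exp (- real n) + real n * rho ^ n / (1 - rho) \<and>
    (\<forall>\<omega>\<in>space perc. \<omega> \<notin> T \<longrightarrow> (\<exists>i\<ge>R. good \<omega> i))" if n: "2 \<le> n" for n
  proof -
    define s where "s = card (lollipop (0,0) n)"
    have s: "card (lollipop (v i) n) = s" for i using card_lollipop s_def by simp
    have "\<exists>S. S \<in> sets perc \<and> perc.prob S \<le> (1/2) ^ s * (rho ^ n / (1 - rho)) \<and>
      (\<forall>\<omega>\<in>space perc. (\<forall>x\<in>lollipop (v i) n. \<omega> (pt x) = c x) \<longrightarrow> \<omega> \<notin> S \<longrightarrow> good \<omega> i)" for i
      using prob_lollipop_finite[OF n, of "v i" c] c s unfolding good_def by (metis (no_types, lifting))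
    then obtain S where S: "\<And>i. S i \<in> sets perc" "\<And>i. perc.prob (S i) \<le> (1/2) ^ s * (rho ^ n / (1 - rho))"
      "\<And>i \<omega>. \<omega> \<in> space perc \<Longrightarrow> (\<forall>x\<in>lollipop (v i) n. \<omega> (pt x) = c x) \<Longrightarrow> \<omega> \<notin> S i \<Longrightarrow> good \<omega> i"
      by metis
    define K where "K = {R..<R + n * 2 ^ s}"
    define E where "E = event (\<lambda>\<eta>. (\<forall>x\<in>{}. \<eta> x = c x) \<and> (\<forall>i\<in>K. \<not> (\<forall>x\<in>lollipop (v i) n. \<eta> x = c x)))"
    have "E \<in> sets perc \<and> perc.prob E = (1/2) ^ card ({} :: (int \<times> int) set) * (\<Prod>i\<in>K. 1 - (1/2) ^ card (lollipop (v i) n))"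
      unfolding E_def by (rule prob_pattern_avoid) (use disj in \<open>simp_all add: K_def\<close>)
    then have E: "E \<in> sets perc" "perc.prob E = (1 - (1/2) ^ s) ^ (n * 2 ^ s)"
      by (simp_all add: s K_def)
    have "(1 - (1/2::real) ^ s) ^ (n * 2 ^ s) \<le> exp (- ((1/2) ^ s)) ^ (n * 2 ^ s)"
      using exp_ge_add_one_self[of "- ((1/2::real) ^ s)"] by (intro power_mono) (auto simp: power_le_one)
    also have "\<dots> = exp (- real n)"
      by (simp add: exp_of_nat_mult[symmetric] power_one_over)
    finally have PE: "perc.prob E \<le> exp (- real n)" using E by simp
    define T where "T = E \<union> (\<Union>i\<in>K. S i)"
    have "(\<Union>i\<in>K. S i) \<in> sets perc" using S(1) by (auto simp: K_def)
    have "perc.prob (\<Union>i\<in>K. S i) \<le> (\<Sum>i\<in>K. perc.prob (S i))"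
      using S(1) by (intro perc.finite_measure_subadditive_finite) (auto simp: K_def)
    also have "\<dots> \<le> (\<Sum>i\<in>K. (1/2) ^ s * (rho ^ n / (1 - rho)))" by (rule sum_mono) (rule S)
    also have "\<dots> = real n * rho ^ n / (1 - rho)" by (simp add: K_def power_one_over)
    finally have "perc.prob T \<le> exp (- real n) + real n * rho ^ n / (1 - rho)"
      using measure_Un_le[OF E(1) \<open>(\<Union>i\<in>K. S i) \<in> sets perc\<close>] PE unfolding T_def by linarith
    moreover have "T \<in> sets perc" using E \<open>(\<Union>i\<in>K. S i) \<in> sets perc\<close> unfolding T_def by auto
    moreover have "\<exists>i\<ge>R. good \<omega> i" if \<omega>: "\<omega> \<in> space perc" "\<omega> \<notin> T" for \<omega>
    proof -
      have "\<omega> \<notin> E" using \<omega> by (simp add: T_def)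
      then obtain i where "i \<in> K" "\<forall>x\<in>lollipop (v i) n. \<omega> (pt x) = c x"
        using \<omega>(1) unfolding E_def event_def by auto
      then have "good \<omega> i" using S(3)[of \<omega> i] \<omega> by (auto simp: T_def)
      then show ?thesis using \<open>i \<in> K\<close> by (auto simp: K_def)
    qed
    ultimately show ?thesis by blast
  qed
  then obtain T where T: "\<And>n. 2 \<le> n \<Longrightarrow> T n \<in> sets perc"
    "\<And>n. 2 \<le> n \<Longrightarrow> perc.prob (T n) \<le> exp (- real n) + real n * rho ^ n / (1 - rho)"
    "\<And>n \<omega>. 2 \<le> n \<Longrightarrow> \<omega> \<in> space perc \<Longrightarrow> \<omega> \<notin> T n \<Longrightarrow> \<exists>i\<ge>R. good \<omega> i"
    by metis
  define N where "N = (\<Inter>n. T (n + 2))"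
  have N: "N \<in> sets perc" unfolding N_def using T(1) by (intro sets.countable_INT) auto
  have "perc.prob N \<le> exp (- real n) + real n * rho ^ n / (1 - rho)" if "2 \<le> n" for n
  proof -
    have "N \<subseteq> T (n - 2 + 2)" unfolding N_def by blast
    then have "N \<subseteq> T n" using that by (simp only: le_add_diff_inverse2)
    then have "perc.prob N \<le> perc.prob (T n)" using T(1)[OF that] by (intro perc.finite_measure_mono)
    then show ?thesis using T(2)[OF that] by simp
  qed
  moreover have "(\<lambda>n. exp (- real n) + real n * rho ^ n / (1 - rho)) \<longlonglongrightarrow> 0 + 0 / (1 - rho)"
  proof (intro tendsto_add tendsto_divide tendsto_const)
    show "(\<lambda>n. exp (- real n)) \<longlonglongrightarrow> 0"
      by (rule filterlim_compose[OF exp_at_bot])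
        (simp add: filterlim_uminus_at_bot filterlim_real_sequentially)
    show "(\<lambda>n. real n * rho ^ n) \<longlonglongrightarrow> 0" using powser_times_n_limit_0[of rho] rho by simp
  qed (use rho in simp)
  ultimately have "perc.prob N \<le> 0" by (intro LIMSEQ_le_const[of _ 0]) auto
  then have "N \<in> null_sets perc"
    using N by (simp add: null_sets_def perc.emeasure_eq_measure measure_le_0_iff)
  moreover have "\<omega> \<in> N" if "\<omega> \<in> space perc" "\<not> (\<exists>i\<ge>R. good \<omega> i)" for \<omega>
    unfolding N_def using T(3)[of _ \<omega>] that by (metis INT_I le_add2)
  then have "{\<omega> \<in> space perc. \<not> (\<exists>i\<ge>R. good \<omega> i)} \<subseteq> N" by blast
  ultimately have "AE \<omega> in perc. \<exists>i\<ge>R. good \<omega> i" by (rule AE_I')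
  then show "AE \<omega> in perc. \<exists>i\<ge>R. (0, 5 * int i) \<in> opens \<omega> \<and> (\<forall>u. adj (0, 5 * int i) u \<longrightarrow> u \<notin> opens \<omega>) \<and>
     infinite (linked (opens \<omega>) (0, 5 * int i))"
    by (simp add: good_def v_def)
qed

subsection \<open>The cluster graph\<close>

text \<open>The squared distance is the form \<open>x\<^sup>2 + x * y + y\<^sup>2\<close>;
  completing the square after multiplication by 4 bounds both differences by 1.\<close>

lemma site_adj_pt: "(pt u, pt v) \<in> site_adj \<longleftrightarrow> adj u v"
proof -
  obtain a b where u: "u = (a, b)" by fastforce
  obtain c d where v: "v = (c, d)" by fastforce
  define x y where "x = c - a" and "y = d - b"
  have "(dist (pt u) (pt v))\<^sup>2 = (of_int x + of_int y / 2)\<^sup>2 + (of_int y * sqrt 3 / 2)\<^sup>2"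
  proof -
    have "pt u - pt v = Complex (- (of_int x + of_int y / 2)) (- (of_int y * sqrt 3 / 2))"
      by (simp add: pt_Complex u v x_def y_def complex_eq_iff field_simps)
    then show ?thesis unfolding dist_norm cmod_power2 by (simp only: complex.sel power2_minus)
  qed
  also have "\<dots> = of_int (x\<^sup>2 + x * y + y\<^sup>2)"
    by (simp add: power_mult_distrib power_divide) (simp add: power2_eq_square field_simps)
  finally have D: "(dist (pt u) (pt v))\<^sup>2 = of_int (x\<^sup>2 + x * y + y\<^sup>2)" .
  have "dist (pt u) (pt v) = 1 \<longleftrightarrow> (dist (pt u) (pt v))\<^sup>2 = 1"
    using zero_le_dist[of "pt u" "pt v"] by (metis one_power2 power2_eq_iff_nonneg zero_le_one)
  also have "\<dots> \<longleftrightarrow> x\<^sup>2 + x * y + y\<^sup>2 = 1" unfolding D by (metis of_int_1 of_int_eq_iff)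
  also have "\<dots> \<longleftrightarrow> adj u v"
  proof
    assume 1: "x\<^sup>2 + x * y + y\<^sup>2 = 1"
    have "(2 * x + y)\<^sup>2 + 3 * y\<^sup>2 = 4" "(2 * y + x)\<^sup>2 + 3 * x\<^sup>2 = 4"
      using 1 by (simp_all add: power2_eq_square algebra_simps)
    then have "y\<^sup>2 \<le> 1" "x\<^sup>2 \<le> 1" using zero_le_power2[of "2 * x + y"] zero_le_power2[of "2 * y + x"] by linarith+
    then have "\<bar>x\<bar> \<le> 1" "\<bar>y\<bar> \<le> 1" using abs_square_le_1 by auto
    then have "x = -1 \<or> x = 0 \<or> x = 1" "y = -1 \<or> y = 0 \<or> y = 1" by linarith+
    then have "(x, y) \<in> {(1,0), (0,1), (-1,1), (-1,0), (0,-1), (1,-1)}" using 1 by auto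
    then show "adj u v" by (simp only: adj_def u v x_def y_def diff_Pair)
  next
    assume "adj u v"
    then have "(x, y) \<in> {(1,0), (0,1), (-1,1), (-1,0), (0,-1), (1,-1)}" by (simp only: adj_def u v x_def y_def diff_Pair)
    then show "x\<^sup>2 + x * y + y\<^sup>2 = 1" by auto
  qed
  finally show ?thesis by (simp add: site_adj_def)
qed

section \<open>Clusters in integer coordinates\<close>

definition steps :: "(int \<times> int) set \<Rightarrow> ((int \<times> int) \<times> (int \<times> int)) set" where
  "steps S = {(u, v). u \<in> S \<and> v \<in> S \<and> adj u v}"

definition cluster :: "(int \<times> int) set \<Rightarrow> int \<times> int \<Rightarrow> (int \<times> int) set" where
  "cluster S u = {v. (u, v) \<in> (steps S)\<^sup>*}"

lemma sym_steps: "sym (steps S)"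
  by (auto simp: sym_def steps_def adj_sym)

lemma self_cluster: "u \<in> cluster S u"
  by (simp add: cluster_def)

lemma cluster_eq_iff: "cluster S u = cluster S v \<longleftrightarrow> (u, v) \<in> (steps S)\<^sup>*"
proof
  assume "cluster S u = cluster S v"
  then have "v \<in> cluster S u" using self_cluster by blast
  then show "(u, v) \<in> (steps S)\<^sup>*" by (simp add: cluster_def)
next
  assume uv: "(u, v) \<in> (steps S)\<^sup>*"
  then have "(v, u) \<in> (steps S)\<^sup>*" using sym_rtrancl[OF sym_steps] by (auto dest: symD)
  then show "cluster S u = cluster S v" using uv unfolding cluster_def by (auto intro: rtrancl_trans)
qed

lemma steps_subset_links: "steps S \<subseteq> links S"
  by (auto simp: steps_def links_def adj_link)

lemma cluster_subset_linked: "cluster S u \<subseteq> linked S u"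
  using rtrancl_mono[OF steps_subset_links] by (auto simp: cluster_def linked_def)

lemma cluster_subset: "u \<in> S \<Longrightarrow> cluster S u \<subseteq> S"
  using cluster_subset_linked linked_subset by blast

lemma open_sites_eq: "open_sites \<omega> = pt ` opens \<omega>"
  by (auto simp: open_sites_def opens_def sites_eq)

lemma rtrancl_site_adj:
  "(pt u, z) \<in> (site_adj \<inter> open_sites \<omega> \<times> open_sites \<omega>)\<^sup>* \<longleftrightarrow> z \<in> pt ` cluster (opens \<omega>) u"
proof
  assume "(pt u, z) \<in> (site_adj \<inter> open_sites \<omega> \<times> open_sites \<omega>)\<^sup>*"
  then show "z \<in> pt ` cluster (opens \<omega>) u"
  proof (induction rule: rtrancl_induct)
    case (step y z)
    then obtain a b where ab: "y = pt a" "a \<in> cluster (opens \<omega>) u" "z = pt b" "a \<in> opens \<omega>" "b \<in> opens \<omega>"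
      by (force simp: open_sites_eq)
    then have "(a, b) \<in> steps (opens \<omega>)" using step(2) site_adj_pt by (simp add: steps_def)
    then have "b \<in> cluster (opens \<omega>) u" using ab by (auto simp: cluster_def)
    then show ?case using ab by blast
  qed (use self_cluster in blast)
next
  assume "z \<in> pt ` cluster (opens \<omega>) u"
  then obtain v where "(u, v) \<in> (steps (opens \<omega>))\<^sup>*" "z = pt v" by (auto simp: cluster_def)
  from this(1) have "(pt u, pt v) \<in> (site_adj \<inter> open_sites \<omega> \<times> open_sites \<omega>)\<^sup>*"
  proof (induction rule: rtrancl_induct)
    case (step a b)
    then have "(pt a, pt b) \<in> site_adj \<inter> open_sites \<omega> \<times> open_sites \<omega>"
      using site_adj_pt by (simp add: steps_def open_sites_eq)
    then show ?case by (rule rtrancl_into_rtrancl[OF step.IH])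
  qed simp
  then show "(pt u, z) \<in> (site_adj \<inter> open_sites \<omega> \<times> open_sites \<omega>)\<^sup>*" using \<open>z = pt v\<close> by simp
qed

definition site_cluster :: "(complex \<Rightarrow> bool) \<Rightarrow> int \<times> int \<Rightarrow> complex set" where
  "site_cluster \<omega> u = pt ` cluster (opens \<omega>) u"

lemma site_cluster_eq_iff: "site_cluster \<omega> u = site_cluster \<omega> v \<longleftrightarrow> (u, v) \<in> (steps (opens \<omega>))\<^sup>*"
  unfolding site_cluster_def by (simp add: inj_image_eq_iff[OF inj_pt] cluster_eq_iff)

lemma open_clusters_eq: "open_clusters \<omega> = site_cluster \<omega> ` opens \<omega>"
proof -
  have "{(u, v). u \<in> open_sites \<omega> \<and> v \<in> open_sites \<omega> \<and> (u, v) \<in> (site_adj \<inter> open_sites \<omega> \<times> open_sites \<omega>)\<^sup>*} `` {pt u}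
      = site_cluster \<omega> u" if "u \<in> opens \<omega>" for u
    using that cluster_subset[OF that] unfolding Image_singleton mem_Collect_eq case_prod_conv rtrancl_site_adj
    by (auto simp: site_cluster_def open_sites_eq)
  then show ?thesis
    unfolding open_clusters_def connected_components_def quotient_def open_sites_eq[of \<omega>] by auto
qed

lemma cluster_adj_iff:
  assumes "u \<in> opens \<omega>" "v \<in> opens \<omega>"
  shows "(site_cluster \<omega> u, site_cluster \<omega> v) \<in> cluster_adj \<omega> \<longleftrightarrow> site_cluster \<omega> u \<noteq> site_cluster \<omega> v \<and>
    (\<exists>z\<in>- opens \<omega>. (\<exists>a\<in>cluster (opens \<omega>) u. adj z a) \<and> (\<exists>b\<in>cluster (opens \<omega>) v. adj z b))"
proof -
  have "closed_sites \<omega> = pt ` (- opens \<omega>)" by (auto simp: closed_sites_def opens_def sites_eq)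
  moreover have "site_cluster \<omega> u \<in> open_clusters \<omega>" "site_cluster \<omega> v \<in> open_clusters \<omega>"
    using assms by (auto simp: open_clusters_eq)
  ultimately show ?thesis
    unfolding cluster_adj_def mem_Collect_eq case_prod_conv
    unfolding site_cluster_def by (simp only: Set.bex_simps(7) site_adj_pt simp_thms)
qed

lemma cluster_adj_sites:
  assumes "(A, B) \<in> cluster_adj \<omega>" obtains u v where "u \<in> opens \<omega>" "v \<in> opens \<omega>" "A = site_cluster \<omega> u" "B = site_cluster \<omega> v"
  using assms unfolding cluster_adj_def open_clusters_eq by blast

text \<open>Let \<open>z\<close> be the site through which two open sites are linked. If
  \<open>z\<close> is open, they lie in one cluster; if it is closed, their clusters coincide or are
  adjacent. Conversely, adjacent clusters contain linked sites.\<close>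

lemma rtrancl_cluster_adj:
  assumes u: "u \<in> opens \<omega>"
  shows "(site_cluster \<omega> u, X) \<in> (cluster_adj \<omega>)\<^sup>* \<longleftrightarrow> X \<in> site_cluster \<omega> ` linked (opens \<omega>) u"
proof
  assume "(site_cluster \<omega> u, X) \<in> (cluster_adj \<omega>)\<^sup>*"
  then show "X \<in> site_cluster \<omega> ` linked (opens \<omega>) u"
  proof (induction rule: rtrancl_induct)
    case base then show ?case using self_linked by blast
  next
    case (step Y Z)
    then obtain v where v: "v \<in> linked (opens \<omega>) u" "Y = site_cluster \<omega> v" by blast
    then have vo: "v \<in> opens \<omega>" using linked_subset[OF u] by blast
    obtain w where w: "w \<in> opens \<omega>" "Z = site_cluster \<omega> w" using cluster_adj_sites[OF step(2)] by metis
    obtain z a b where z: "a \<in> cluster (opens \<omega>) v" "b \<in> cluster (opens \<omega>) w" "adj z a" "adj z b"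
      using step(2) cluster_adj_iff[OF vo w(1)] v w by blast
    have "a \<in> linked (opens \<omega>) u" using z(1) cluster_subset_linked v(1) linked_trans by blast
    moreover have "link a b" using z unfolding link_def nbh_single by blast
    moreover have "b \<in> opens \<omega>" using z(2) cluster_subset[OF w(1)] by blast
    ultimately have "b \<in> linked (opens \<omega>) u" using linked_link u by blast
    moreover have "Z = site_cluster \<omega> b" using z(2) w(2) site_cluster_eq_iff by (simp add: cluster_def)
    ultimately show ?case by blast
  qed
next
  assume "X \<in> site_cluster \<omega> ` linked (opens \<omega>) u"
  then obtain v where "(u, v) \<in> (links (opens \<omega>))\<^sup>*" "X = site_cluster \<omega> v" by (auto simp: linked_def)
  from this(1) have "(site_cluster \<omega> u, site_cluster \<omega> v) \<in> (cluster_adj \<omega>)\<^sup>*"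
  proof (induction rule: rtrancl_induct)
    case (step v w)
    then obtain z where z: "v \<in> nbh {z}" "w \<in> nbh {z}" and vw: "v \<in> opens \<omega>" "w \<in> opens \<omega>"
      by (auto simp: links_def link_def)
    have "(site_cluster \<omega> v, site_cluster \<omega> w) \<in> (cluster_adj \<omega>)\<^sup>*"
    proof (cases "z \<in> opens \<omega>")
      case True
      have "(x, z) \<in> (steps (opens \<omega>))\<^sup>*" if "x \<in> nbh {z}" "x \<in> opens \<omega>" for x
        using that True adj_sym by (cases "x = z") (auto simp: nbh_single steps_def)
      then have "site_cluster \<omega> v = site_cluster \<omega> z" "site_cluster \<omega> w = site_cluster \<omega> z"
        using z vw site_cluster_eq_iff by blast+
      then show ?thesis by simp
    next
      case False
      then have "adj z v" "adj z w" using z vw unfolding nbh_single by blast+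
      then show ?thesis
        using False cluster_adj_iff[OF vw] self_cluster[of v] self_cluster[of w]
        by (cases "site_cluster \<omega> v = site_cluster \<omega> w") (simp, blast)
    qed
    then show ?case using step.IH by auto
  qed simp
  then show "(site_cluster \<omega> u, X) \<in> (cluster_adj \<omega>)\<^sup>*" using \<open>X = site_cluster \<omega> v\<close> by simp
qed

section \<open>The infinite component as a set of sites\<close>

definition in_infinite :: "(complex \<Rightarrow> bool) \<Rightarrow> int \<times> int \<Rightarrow> bool" where
  "in_infinite \<omega> u \<longleftrightarrow> u \<in> opens \<omega> \<and> infinite (site_cluster \<omega> ` linked (opens \<omega>) u)"

lemma infinite_component_iff:
  "infinite_component \<omega> K \<longleftrightarrow> (\<exists>u. in_infinite \<omega> u \<and> K = site_cluster \<omega> ` linked (opens \<omega>) u)"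
proof -
  have r: "cluster_adj \<omega> \<inter> open_clusters \<omega> \<times> open_clusters \<omega> = cluster_adj \<omega>"
    by (auto simp: cluster_adj_def)
  have "{(A, B). A \<in> open_clusters \<omega> \<and> B \<in> open_clusters \<omega> \<and> (A, B) \<in> (cluster_adj \<omega>)\<^sup>*} `` {site_cluster \<omega> u}
      = site_cluster \<omega> ` linked (opens \<omega>) u" if u: "u \<in> opens \<omega>" for u
    using u linked_subset[OF u] unfolding Image_singleton mem_Collect_eq case_prod_conv rtrancl_cluster_adj[OF u]
    by (auto simp: open_clusters_eq)
  then have comps: "connected_components (open_clusters \<omega>) (cluster_adj \<omega>) = (\<lambda>u. site_cluster \<omega> ` linked (opens \<omega>) u) ` opens \<omega>"
    unfolding connected_components_def r quotient_def UNION_singleton_eq_range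
    by (subst (3) open_clusters_eq, unfold image_image) (rule image_cong[OF refl])
  show ?thesis unfolding infinite_component_def in_infinite_def comps by blast
qed

definition unique_infinite :: "(complex \<Rightarrow> bool) \<Rightarrow> bool" where
  "unique_infinite \<omega> \<longleftrightarrow> (\<exists>u. in_infinite \<omega> u) \<and> (\<forall>u v. in_infinite \<omega> u \<longrightarrow> in_infinite \<omega> v \<longrightarrow> v \<in> linked (opens \<omega>) u)"

lemma unique_infinite_iff: "unique_infinite \<omega> \<longleftrightarrow> (\<exists>!K. infinite_component \<omega> K)"
proof
  assume u: "unique_infinite \<omega>"
  then obtain u where u1: "in_infinite \<omega> u" by (auto simp: unique_infinite_def)
  show "\<exists>!K. infinite_component \<omega> K"
  proof (rule ex1I[of _ "site_cluster \<omega> ` linked (opens \<omega>) u"])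
    show "infinite_component \<omega> (site_cluster \<omega> ` linked (opens \<omega>) u)" using u1 infinite_component_iff by blast
    fix K assume "infinite_component \<omega> K"
    then obtain v where "in_infinite \<omega> v" "K = site_cluster \<omega> ` linked (opens \<omega>) v" using infinite_component_iff by blast
    then show "K = site_cluster \<omega> ` linked (opens \<omega>) u"
      using u u1 linked_eq unfolding unique_infinite_def by metis
  qed
next
  assume ex1: "\<exists>!K. infinite_component \<omega> K"
  have "v \<in> linked (opens \<omega>) u" if uv: "in_infinite \<omega> u" "in_infinite \<omega> v" for u v
  proof -
    have "site_cluster \<omega> ` linked (opens \<omega>) u = site_cluster \<omega> ` linked (opens \<omega>) v"
      using ex1 uv infinite_component_iff by blast
    moreover have "site_cluster \<omega> v \<in> site_cluster \<omega> ` linked (opens \<omega>) v" by (intro imageI self_linked)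
    ultimately have "site_cluster \<omega> v \<in> site_cluster \<omega> ` linked (opens \<omega>) u" by simp
    then obtain w where w: "w \<in> linked (opens \<omega>) u" "site_cluster \<omega> v = site_cluster \<omega> w" by (rule imageE)
    then have "v \<in> cluster (opens \<omega>) w" using site_cluster_eq_iff[of \<omega> w v] by (simp add: cluster_def)
    then show ?thesis using w(1) cluster_subset_linked linked_trans by (meson subsetD)
  qed
  moreover have "\<exists>u. in_infinite \<omega> u" using ex1 unfolding infinite_component_iff by blast
  ultimately show "unique_infinite \<omega>" unfolding unique_infinite_def by simp
qed

lemma Union_the_infinite_component:
  assumes "unique_infinite \<omega>"
  shows "\<Union> (the_infinite_component \<omega>) = pt ` {v. in_infinite \<omega> v}"
proof -
  obtain u where u: "in_infinite \<omega> u" using assms by (auto simp: unique_infinite_def)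
  have ex1: "\<exists>!K. infinite_component \<omega> K" using assms unique_infinite_iff by blast
  have "the_infinite_component \<omega> = site_cluster \<omega> ` linked (opens \<omega>) u"
    unfolding the_infinite_component_def if_P[OF ex1]
    by (rule the1_equality[OF ex1]) (use u infinite_component_iff in blast)
  then have "\<Union> (the_infinite_component \<omega>) = pt ` (\<Union>v\<in>linked (opens \<omega>) u. cluster (opens \<omega>) v)"
    by (simp add: site_cluster_def image_UN)
  also have "(\<Union>v\<in>linked (opens \<omega>) u. cluster (opens \<omega>) v) = linked (opens \<omega>) u"
  proof (intro equalityI UN_least subsetI)
    fix x v assume "v \<in> linked (opens \<omega>) u" "x \<in> cluster (opens \<omega>) v"
    then show "x \<in> linked (opens \<omega>) u"
      using cluster_subset_linked linked_trans by (meson subsetD)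
  qed (use self_cluster in blast)
  also have "linked (opens \<omega>) u = {v. in_infinite \<omega> v}"
  proof (intro equalityI subsetI CollectI)
    fix v assume v: "v \<in> linked (opens \<omega>) u"
    then have "v \<in> opens \<omega>" using u linked_subset unfolding in_infinite_def by blast
    then show "in_infinite \<omega> v" using u linked_eq[OF v] by (simp add: in_infinite_def)
  next
    fix v assume "v \<in> {v. in_infinite \<omega> v}"
    then show "v \<in> linked (opens \<omega>) u" using assms u unfolding unique_infinite_def by blast
  qed
  finally show ?thesis .
qed

text \<open>In this form the sublevel sets involve countably many sites. Without a unique infinite
  component the union is empty, and \<open>infdist\<close> to the empty set is 0, whence the
  condition \<open>0 < a\<close>.\<close>

lemma dist_infinite_component_less:
  "dist_infinite_component \<omega> < a \<longleftrightarrow>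
    (if unique_infinite \<omega> then \<exists>v. in_infinite \<omega> v \<and> norm (pt v) < a else 0 < a)"
proof (cases "unique_infinite \<omega>")
  case True
  then have ne: "pt ` {v. in_infinite \<omega> v} \<noteq> {}" by (auto simp: unique_infinite_def)
  have "dist_infinite_component \<omega> = (INF z\<in>pt ` {v. in_infinite \<omega> v}. dist 0 z)"
    unfolding dist_infinite_component_def Union_the_infinite_component[OF True] by (rule infdist_notempty[OF ne])
  also have "\<dots> < a \<longleftrightarrow> (\<exists>z\<in>pt ` {v. in_infinite \<omega> v}. dist 0 z < a)"
    by (rule cINF_less_iff[OF ne]) (auto intro!: bdd_belowI[of _ 0])
  finally show ?thesis using True by (simp only: bex_simps dist_0_norm) auto
next
  case False
  then have "the_infinite_component \<omega> = {}"
    unfolding the_infinite_component_def unique_infinite_iff by simp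
  then show ?thesis using False by (simp add: dist_infinite_component_def infdist_def)
qed

section \<open>Measurability and almost sure uniqueness\<close>

lemma pred_opens [measurable]: "Measurable.pred perc (\<lambda>\<omega>. u \<in> opens \<omega>)"
  unfolding opens_def mem_Collect_eq by measurable

lemma pred_rtrancl:
  assumes "\<And>u v. Measurable.pred perc (\<lambda>\<omega>. (u :: int \<times> int, v) \<in> R \<omega>)"
  shows "Measurable.pred perc (\<lambda>\<omega>. (u, v) \<in> (R \<omega>)\<^sup>*)"
proof -
  have *: "Measurable.pred perc (\<lambda>\<omega>. (u, v) \<in> R \<omega> ^^ n)" for u v n
  proof (induction n arbitrary: v)
    case 0 then show ?case by simp
  next
    case (Suc n)
    note [measurable] = Suc assms
    have "(\<lambda>\<omega>. (u, v) \<in> R \<omega> ^^ Suc n) = (\<lambda>\<omega>. \<exists>w. (u, w) \<in> R \<omega> ^^ n \<and> (w, v) \<in> R \<omega>)"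
      by (auto simp: fun_eq_iff)
    then show ?case by simp
  qed
  note [measurable] = *
  have "(\<lambda>\<omega>. (u, v) \<in> (R \<omega>)\<^sup>*) = (\<lambda>\<omega>. \<exists>n. (u, v) \<in> R \<omega> ^^ n)"
    by (simp add: fun_eq_iff rtrancl_is_UN_relpow)
  then show ?thesis by simp
qed

lemma pred_linked [measurable]: "Measurable.pred perc (\<lambda>\<omega>. v \<in> linked (opens \<omega>) u)"
  unfolding linked_def mem_Collect_eq
  by (rule pred_rtrancl) (simp add: links_def)

lemma pred_steps [measurable]: "Measurable.pred perc (\<lambda>\<omega>. (u, v) \<in> (steps (opens \<omega>))\<^sup>*)"
  by (rule pred_rtrancl) (simp add: steps_def)

text \<open>A set is infinite iff no finite list exhausts it, and lists of sites form a countable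
  type, so the quantifiers preserve measurability.\<close>

lemma in_infinite_countable:
  "in_infinite \<omega> u \<longleftrightarrow> u \<in> opens \<omega> \<and>
    (\<forall>ws :: (int \<times> int) list. \<exists>v. v \<in> linked (opens \<omega>) u \<and> (\<forall>w\<in>set ws. (v, w) \<notin> (steps (opens \<omega>))\<^sup>*))"
proof -
  let ?A = "linked (opens \<omega>) u" and ?f = "site_cluster \<omega>"
  have "infinite (?f ` ?A) \<longleftrightarrow> (\<forall>ws. \<exists>v. v \<in> ?A \<and> (\<forall>w\<in>set ws. ?f v \<noteq> ?f w))"
  proof
    assume inf: "infinite (?f ` ?A)"
    show "\<forall>ws. \<exists>v. v \<in> ?A \<and> (\<forall>w\<in>set ws. ?f v \<noteq> ?f w)"
    proof (rule allI, rule ccontr)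
      fix ws assume "\<not> (\<exists>v. v \<in> ?A \<and> (\<forall>w\<in>set ws. ?f v \<noteq> ?f w))"
      then have "?f ` ?A \<subseteq> ?f ` set ws" by blast
      then show False using inf finite_subset by blast
    qed
  next
    assume *: "\<forall>ws. \<exists>v. v \<in> ?A \<and> (\<forall>w\<in>set ws. ?f v \<noteq> ?f w)"
    show "infinite (?f ` ?A)"
    proof
      assume "finite (?f ` ?A)"
      then obtain F where "F \<subseteq> ?A" "finite F" "?f ` ?A = ?f ` F" by (meson finite_subset_image order_refl)
      then show False using * finite_list[of F] by (metis imageE imageI)
    qed
  qed
  then show ?thesis by (simp add: in_infinite_def site_cluster_eq_iff)
qed

lemma pred_in_infinite [measurable]: "Measurable.pred perc (\<lambda>\<omega>. in_infinite \<omega> u)"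
  unfolding in_infinite_countable by measurable

lemma pred_unique_infinite [measurable]: "Measurable.pred perc unique_infinite"
  unfolding unique_infinite_def[abs_def] by measurable

lemma dist_infinite_component_measurable: "dist_infinite_component \<in> borel_measurable perc"
  unfolding borel_measurable_iff_less dist_infinite_component_less by measurable

text \<open>By uniqueness, a component with infinitely many sites contains all the isolated sites
  found on the line; each is a cluster of its own, so the number of clusters is infinite as
  well.\<close>

lemma AE_unique_infinite:
  "AE \<omega> in perc. unique_infinite \<omega> \<and> (\<forall>u\<in>opens \<omega>. infinite (linked (opens \<omega>) u) \<longrightarrow> in_infinite \<omega> u)"
  using AE_infinite_linked_unique AE_isolated_far
proof eventually_elim
  case (elim \<omega>)
  let ?S = "opens \<omega>"
  define I where "I = {i::nat. (0, 5 * int i) \<in> ?S \<and> (\<forall>u. adj (0, 5 * int i) u \<longrightarrow> u \<notin> ?S) \<and>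
     infinite (linked ?S (0, 5 * int i))}"
  have "\<forall>R. \<exists>i\<ge>R. i \<in> I" using elim(2) by (simp add: I_def)
  then have "infinite I" by (metis infinite_nat_iff_unbounded_le)
  have iso: "cluster ?S (0, 5 * int i) = {(0, 5 * int i)}" if "i \<in> I" for i
  proof -
    have "v = (0, 5 * int i)" if "((0, 5 * int i), v) \<in> (steps ?S)\<^sup>*" for v
      using that
    proof (induction rule: rtrancl_induct)
      case (step y z)
      then have "adj (0, 5 * int i) z" "z \<in> ?S" by (simp_all add: steps_def)
      then show ?case using \<open>i \<in> I\<close> unfolding I_def by blast
    qed simp
    then show ?thesis by (auto simp: cluster_def)
  qed
  have inf: "in_infinite \<omega> u" if u: "u \<in> ?S" "infinite (linked ?S u)" for u
  proof -
    have sub: "(\<lambda>i. (0, 5 * int i)) ` I \<subseteq> linked ?S u" using elim(1) u by (auto simp: I_def)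
    have "inj_on (\<lambda>i. site_cluster \<omega> (0, 5 * int i)) I"
      by (rule inj_onI) (simp add: site_cluster_def iso)
    then have "infinite ((\<lambda>i. site_cluster \<omega> (0, 5 * int i)) ` I)"
      using \<open>infinite I\<close> finite_imageD by blast
    moreover have "(\<lambda>i. site_cluster \<omega> (0, 5 * int i)) ` I \<subseteq> site_cluster \<omega> ` linked ?S u" using sub by blast
    ultimately have "infinite (site_cluster \<omega> ` linked ?S u)" using finite_subset by blast
    then show ?thesis using u by (simp add: in_infinite_def)
  qed
  obtain i where "i \<in> I" using \<open>infinite I\<close> by (metis ex_in_conv finite.emptyI)
  then have "in_infinite \<omega> (0, 5 * int i)" using inf by (simp add: I_def)
  moreover have "v \<in> linked ?S u" if "in_infinite \<omega> u" "in_infinite \<omega> v" for u v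
    using elim(1) that unfolding in_infinite_def by blast
  ultimately show ?case using inf unfolding unique_infinite_def by blast
qed

section \<open>The tail of the distance\<close>

lemma norm_near_segment:
  assumes "x \<in> nbh (nbh (segment (0,0) n))" shows "norm (pt x) \<le> real n + 2"
proof -
  have step: "norm (pt v) \<le> r + 1" if "v \<in> nbh A" "\<And>u. u \<in> A \<Longrightarrow> norm (pt u) \<le> r" for v A r
  proof -
    obtain u where u: "u \<in> A" "v = u \<or> adj u v" using \<open>v \<in> nbh A\<close> unfolding nbh_def by blast
    then have "dist (pt u) (pt v) \<le> 1" using site_adj_pt[of u v] by (auto simp: site_adj_def)
    then have "norm (pt v) \<le> norm (pt u) + 1"
      using norm_triangle_ineq[of "pt u" "pt v - pt u"] by (simp add: dist_norm norm_minus_commute)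
    then show ?thesis using that(2)[OF u(1)] by simp
  qed
  have "norm (pt u) \<le> real n" if "u \<in> segment (0,0) n" for u
    using that by (auto simp: segment_def pt_def)
  then have "norm (pt u) \<le> real n + 1" if "u \<in> nbh (segment (0,0) n)" for u using step that by blast
  then have "norm (pt x) \<le> real n + 1 + 1" using step[OF assms] by blast
  then show ?thesis by simp
qed

lemma dist_infinite_component_le:
  assumes "unique_infinite \<omega>" "in_infinite \<omega> v" shows "dist_infinite_component \<omega> \<le> norm (pt v)"
  using dist_infinite_component_less[of \<omega> ] assms by (meson not_le order_less_irrefl)

lemma prob_dist_tail:
  assumes "real n + 2 < k"
  shows "perc.prob {\<omega> \<in> space perc. dist_infinite_component \<omega> \<ge> k} \<le> rho ^ n / (1 - rho)"
proof -
  obtain S where S: "S \<in> sets perc" "perc.prob S \<le> rho ^ n / (1 - rho)"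
    "\<And>\<omega>. \<lbrakk>\<omega> \<in> space perc; \<omega> \<notin> S\<rbrakk> \<Longrightarrow>
       \<exists>x\<in>nbh (nbh (segment (0,0) n)). x \<in> opens \<omega> \<and> infinite (linked (opens \<omega>) x)"
    using infinite_near_segment[of n] by blast
  have "AE \<omega> in perc. \<omega> \<in> {\<omega> \<in> space perc. dist_infinite_component \<omega> \<ge> k} \<longrightarrow> \<omega> \<in> S"
    using AE_unique_infinite AE_space
  proof eventually_elim
    case (elim \<omega>)
    show ?case
    proof (intro impI, rule ccontr)
      assume k: "\<omega> \<in> {\<omega> \<in> space perc. dist_infinite_component \<omega> \<ge> k}" and "\<omega> \<notin> S"
      then obtain x where x: "x \<in> nbh (nbh (segment (0,0) n))" "x \<in> opens \<omega>" "infinite (linked (opens \<omega>) x)"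
        using S(3) elim by blast
      then have "dist_infinite_component \<omega> \<le> norm (pt x)" using elim dist_infinite_component_le by blast
      then show False using norm_near_segment[OF x(1)] k assms by simp
    qed
  qed
  then have "perc.prob {\<omega> \<in> space perc. dist_infinite_component \<omega> \<ge> k} \<le> perc.prob S"
    using S(1) by (rule perc.finite_measure_mono_AE)
  then show ?thesis using S(2) by simp
qed

lemma prob_dist_pos:
  obtains \<delta> where "0 < \<delta>" "\<delta> \<le> 1" "\<And>k. 0 < k \<Longrightarrow> perc.prob {\<omega> \<in> space perc. dist_infinite_component \<omega> \<ge> k} \<le> 1 - \<delta>"
proof -
  obtain S where S: "S \<in> sets perc" "perc.prob S > 0"
    "\<And>\<omega>. \<omega> \<in> S \<Longrightarrow> (0,0) \<in> opens \<omega> \<and> infinite (linked (opens \<omega>) (0,0))"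
    using prob_origin_infinite_pos by blast
  show ?thesis
  proof (rule that[of "perc.prob S"])
    fix k :: real assume "0 < k"
    have "AE \<omega> in perc. \<omega> \<in> {\<omega> \<in> space perc. dist_infinite_component \<omega> \<ge> k} \<longrightarrow> \<omega> \<in> space perc - S"
      using AE_unique_infinite
    proof eventually_elim
      case (elim \<omega>)
      have "dist_infinite_component \<omega> \<le> norm (pt (0,0))" if "\<omega> \<in> S"
        using elim S(3)[OF that] dist_infinite_component_le by blast
      moreover have "norm (pt (0,0)) = 0" by (simp add: pt_def)
      ultimately show ?case using \<open>0 < k\<close> by auto
    qed
    then have "perc.prob {\<omega> \<in> space perc. dist_infinite_component \<omega> \<ge> k} \<le> perc.prob (space perc - S)"
      using S(1) by (intro perc.finite_measure_mono_AE) auto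
    then show "perc.prob {\<omega> \<in> space perc. dist_infinite_component \<omega> \<ge> k} \<le> 1 - perc.prob S"
      using perc.prob_compl[OF S(1)] by simp
  qed (use S in auto)
qed

theorem proposition1:
  "(AE \<omega> in site_percolation (1/2). \<exists>!K. infinite_component \<omega> K) \<and>
   dist_infinite_component \<in> borel_measurable (site_percolation (1/2)) \<and>
   (\<exists>C::real. C > 0 \<and> (\<forall>k::real. k \<ge> 1 \<longrightarrow>
      measure (site_percolation (1/2))
        {\<omega> \<in> space (site_percolation (1/2)). dist_infinite_component \<omega> \<ge> k}
      \<le> exp (- C * k)))"
proof (intro conjI)
  show "AE \<omega> in perc. \<exists>!K. infinite_component \<omega> K"
    using AE_unique_infinite by eventually_elim (simp add: unique_infinite_iff)
  show "dist_infinite_component \<in> borel_measurable perc" by (rule dist_infinite_component_measurable)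
  let ?q = "\<lambda>k. perc.prob {\<omega> \<in> space perc. dist_infinite_component \<omega> \<ge> k}"
  obtain \<delta> where \<delta>: "0 < \<delta>" "\<delta> \<le> 1" "\<And>k. 0 < k \<Longrightarrow> ?q k \<le> 1 - \<delta>" using prob_dist_pos by blast
  define l where "l = - ln rho"
  have rho0: "0 < rho" using rho by linarith
  have l: "0 < l" using rho rho0 by (simp add: l_def)
  \<comment> \<open>Since \<open>n \<ge> k - 3\<close>, the tail is at most
    \<open>exp (c - l * k)\<close>. From \<open>2 * c / l\<close> on, half of the exponent absorbs
    \<open>c\<close>; below \<open>k1\<close> the bound \<open>1 - \<delta>\<close> takes over, and
    \<open>C \<le> \<delta> / k1\<close> makes it sufficient.\<close>
  define c where "c = - ln (1 - rho) + 3 * l"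
  define k1 where "k1 = max 3 (2 * c / l)"
  define C where "C = min (l / 2) (\<delta> / k1)"
  have k1: "3 \<le> k1" by (simp add: k1_def)
  have "0 < C" using l \<delta> k1 by (simp add: C_def)
  moreover have "?q k \<le> exp (- C * k)" if k: "1 \<le> k" for k
  proof (cases "k1 \<le> k")
    case True
    \<comment> \<open>The largest integer with \<open>n + 2 < k\<close>; it is nonnegative because
      \<open>k \<ge> k1 \<ge> 3\<close>.\<close>
    define n where "n = nat (\<lceil>k\<rceil> - 3)"
    have "3 \<le> k" using True k1 by simp
    then have "3 \<le> \<lceil>k\<rceil>" by linarith
    then have n: "real n = of_int \<lceil>k\<rceil> - 3" by (simp add: n_def)
    have "real n + 2 < k" "k - 3 \<le> real n" using n by linarith+
    then have "?q k \<le> rho ^ n / (1 - rho)" using prob_dist_tail by blast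
    also have "\<dots> = exp (- ln (1 - rho) - l * real n)"
    proof -
      have "exp (- l * real n) = rho ^ n" using rho0 by (simp add: l_def exp_of_nat2_mult)
      moreover have "exp (- ln (1 - rho)) = 1 / (1 - rho)" using rho by (simp add: exp_minus inverse_eq_divide)
      moreover have "- ln (1 - rho) - l * real n = - ln (1 - rho) + - l * real n" by simp
      ultimately show ?thesis by (simp only: exp_add) simp
    qed
    also have "\<dots> \<le> exp (c - l * k)"
      using mult_left_mono[OF \<open>k - 3 \<le> real n\<close>, of l] l by (simp add: c_def algebra_simps)
    also have "\<dots> \<le> exp (- C * k)"
    proof -
      have "2 * c / l \<le> k" using True by (simp add: k1_def)
      then have "2 * c \<le> l * k" using l by (simp add: field_simps)
      moreover have "C \<le> l / 2" unfolding C_def by (rule min.cobounded1)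
      then have "C * k \<le> l / 2 * k" using k by (intro mult_right_mono) auto
      ultimately show ?thesis by simp
    qed
    finally show ?thesis .
  next
    case False
    have "?q k \<le> 1 - \<delta>" using \<delta>(3) k by simp
    also have "\<dots> \<le> exp (- \<delta>)" using exp_ge_add_one_self[of "- \<delta>"] by simp
    also have "\<dots> \<le> exp (- C * k)"
    proof -
      have "C * k \<le> \<delta> / k1 * k1" using False k k1 \<delta> by (intro mult_mono) (auto simp: C_def)
      then show ?thesis using k1 by simp
    qed
    finally show ?thesis .
  qed
  ultimately show "\<exists>C::real. C > 0 \<and> (\<forall>k::real. k \<ge> 1 \<longrightarrow> ?q k \<le> exp (- C * k))" by blast
qed

end
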